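(* Let $\lambda,\Lambda>0$, $n=k+l$, and let $u\in C^\infty(\mathbb R^k\times\mathbb R^l)$ satisfy $\lambda I_k\le(u_{x_ix_j})\le\Lambda I_k$ and $\lambda I_l\le(-u_{y_iy_j})\le\Lambda I_l$ everywhere on $\mathbb R^n=\mathbb R^k\times\mathbb R^l$. If $$\log\det(u_{x_ix_j})-\log\det(-u_{y_iy_j})=0\quad\text{on }\mathbb R^n,$$ then $u$ is a quadratic polynomial.
   Context: $(x_1,\dots,x_k,y_1,\dots,y_l)$ are coordinates on $\mathbb R^k\times\mathbb R^l$; subscripts denote partial derivatives; matrix inequalities are in the sense of symmetric matrices. "Quadratic polynomial" means a polynomial of degree at most $2$ in all variables. *)

theory Defs
  imports "HOL-Analysis.Analysis"
begin

primrec C_k :: "nat \<Rightarrow> ('a::euclidean_space \<Rightarrow> real) \<Rightarrow> bool" where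
  "C_k 0 f \<longleftrightarrow> continuous_on UNIV f"
| "C_k (Suc m) f \<longleftrightarrow>
     (\<forall>z. f differentiable (at z)) \<and> (\<forall>v. C_k m (\<lambda>z. frechet_derivative f (at z) v))"

definition C_infinity :: "('a::euclidean_space \<Rightarrow> real) \<Rightarrow> bool" where
  "C_infinity f \<longleftrightarrow> (\<forall>m. C_k m f)"

definition partial :: "'a::euclidean_space \<Rightarrow> ('a \<Rightarrow> real) \<Rightarrow> 'a \<Rightarrow> real" where
  "partial b f z = deriv (\<lambda>t. f (z + t *\<^sub>R b)) 0"

(* A point of the product is (x, y); the coordinate directions of x_i and y_i are
   (axis i 1, 0) and (0, axis i 1). *)
definition hess_x :: "((real^'k) \<times> (real^'l) \<Rightarrow> real) \<Rightarrow> (real^'k) \<times> (real^'l) \<Rightarrow> real^'k^'k" where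
  "hess_x u z = (\<chi> i j. partial (axis j 1, 0) (partial (axis i 1, 0) u) z)"

definition hess_y :: "((real^'k) \<times> (real^'l) \<Rightarrow> real) \<Rightarrow> (real^'k) \<times> (real^'l) \<Rightarrow> real^'l^'l" where
  "hess_y u z = (\<chi> i j. partial (0, axis j 1) (partial (0, axis i 1) u) z)"

(* The order of symmetric matrices: B - A is positive semidefinite. Symmetry is not part of
   the relation, since the Hessian blocks of a smooth function are symmetric anyway. *)
definition matrix_le :: "real^'m^'m \<Rightarrow> real^'m^'m \<Rightarrow> bool" where
  "matrix_le A B \<longleftrightarrow> (\<forall>v. 0 \<le> v \<bullet> ((B - A) *v v))"

(* Total degree at most 2; the coordinates of z are the z \<bullet> b for b in Basis. *)
definition quadratic_polynomial :: "('a::euclidean_space \<Rightarrow> real) \<Rightarrow> bool" where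
  "quadratic_polynomial f \<longleftrightarrow>
     (\<exists>(c::real) (p :: 'a \<Rightarrow> real) (q :: 'a \<Rightarrow> 'a \<Rightarrow> real). \<forall>z.
        f z = c + (\<Sum>b\<in>Basis. p b * (z \<bullet> b))
                + (\<Sum>a\<in>Basis. \<Sum>b\<in>Basis. q a b * (z \<bullet> a) * (z \<bullet> b)))"

end

theory Submission
  imports Defs
begin

text \<open>
  The two Hessian blocks define a Riemannian metric
  \<open>g = u\<^sub>x\<^sub>x dx dx - u\<^sub>y\<^sub>y dy dy\<close> on the whole space, bounded below by \<open>lam\<close> times the Euclidean
  one. The partial Legendre transform of \<open>u\<close> in \<open>y\<close> turns the equation into the Monge-Ampere
  equation \<open>det D\<^sup>2v = 1\<close>; read in the coordinates \<open>(x, y)\<close>, the Hessian metric of \<open>v\<close> is \<open>g\<close>, the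
  cubic form of third derivatives of \<open>v\<close> is the third derivative \<open>D\<^sup>3u\<close>, and the coordinate
  functions are \<open>g\<close>-harmonic, so that the Laplacian is \<open>g\<^sup>a\<^sup>b \<partial>\<^sub>a \<partial>\<^sub>b\<close> without first order terms. This is
  Calabi's setting: the largest value \<open>\<mu>(z)\<close> of \<open>D\<^sup>3u(z)(e, e, e)\<close> over \<open>g\<close>-unit vectors \<open>e\<close>
  satisfies a differential inequality \<open>\<Delta>\<mu> \<ge> c \<mu>\<^sup>3\<close> with \<open>c > 0\<close>. As the coefficients of the Laplacian
  are bounded, comparison with a function blowing up at the boundary of a ball of radius \<open>R\<close> gives
  \<open>\<mu>(z) \<le> const * R / (R\<^sup>2 - |z|\<^sup>2)\<close>, hence \<open>\<mu> = 0\<close> as \<open>R\<close> tends to infinity. Then \<open>D\<^sup>3u = 0\<close>, and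
  \<open>u\<close> is its own Taylor polynomial of degree two.

  The argument is carried out on \<open>u\<close> itself, the Legendre transform serving only as a guide to the
  formulas. The product \<open>(R\<^sup>2 - |z|\<^sup>2) D\<^sup>3u(z)(e, e, e)\<close> is maximised over the ball and
  the \<open>g\<close>-unit vectors. At a maximum \<open>(z, e)\<close> the second derivative test is applied along the lines
  in the directions of a \<open>g\<close>-orthonormal frame, while the vector \<open>e\<close> is moved along the line so as to be
  \<open>g\<close>-parallel to first order (\<open>line_inequality\<close>). Summing over the frame, the derivatives of \<open>u\<close> of
  orders five and four that occur are eliminated by differentiating the logarithms of the two determinants
  two and three times along lines (\<open>frame_equation_derivatives\<close>). What remains (\<open>frame_inequality\<close>) is
  algebra in the symmetric matrix \<open>M\<close> of the form \<open>D\<^sup>3u(e, -, -)\<close>: the combination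
  \<open>(3/4) \<mu> tr M\<^sup>2 - (1/2) tr M\<^sup>3\<close>, which is positive because the maximality of \<open>e\<close> bounds \<open>M\<close> from
  above by a multiple of \<open>\<mu>\<close> less than \<open>3/2\<close> (\<open>cubic_bound\<close>). The radius enters in
  \<open>interior_cubic_bound\<close>.
\<close>

section \<open>Iterated directional derivatives\<close>

definition dir_deriv :: "'a::euclidean_space \<Rightarrow> ('a \<Rightarrow> real) \<Rightarrow> 'a \<Rightarrow> real" where
  "dir_deriv v f z = frechet_derivative f (at z) v"

definition iter_deriv :: "('a::euclidean_space \<Rightarrow> real) \<Rightarrow> 'a list \<Rightarrow> 'a \<Rightarrow> real" where
  "iter_deriv f vs = foldr dir_deriv vs f"

lemma iter_deriv_Nil [simp]: "iter_deriv f [] = f"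
  by (simp add: iter_deriv_def)

lemma iter_deriv_Cons: "iter_deriv f (v # vs) = dir_deriv v (iter_deriv f vs)"
  by (simp add: iter_deriv_def)

lemma C_infinity_differentiable: "C_infinity f \<Longrightarrow> f differentiable (at z)"
  using C_k.simps(2) unfolding C_infinity_def by blast

lemma C_infinity_dir_deriv: "C_infinity f \<Longrightarrow> C_infinity (dir_deriv v f)"
  unfolding C_infinity_def dir_deriv_def[abs_def] using C_k.simps(2) by blast

lemma C_infinity_continuous: "C_infinity f \<Longrightarrow> continuous_on UNIV f"
  unfolding C_infinity_def using C_k.simps(1) by blast

lemma C_infinity_iter_deriv: "C_infinity f \<Longrightarrow> C_infinity (iter_deriv f vs)"
  by (induction vs) (auto simp: iter_deriv_Cons C_infinity_dir_deriv)

lemma dir_deriv_line: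
  assumes "C_infinity f"
  shows "((\<lambda>t. f (z + t *\<^sub>R a)) has_real_derivative dir_deriv a f (z + t *\<^sub>R a)) (at t)"
proof -
  let ?F = "frechet_derivative f (at (z + t *\<^sub>R a))"
  have F: "(f has_derivative ?F) (at (z + t *\<^sub>R a))"
    using C_infinity_differentiable[OF assms] frechet_derivative_works by blast
  have "((\<lambda>t. z + t *\<^sub>R a) has_derivative (\<lambda>t. t *\<^sub>R a)) (at t)"
    by (auto intro!: derivative_eq_intros)
  from has_derivative_compose[OF this F]
  have "((\<lambda>t. f (z + t *\<^sub>R a)) has_derivative (\<lambda>t. ?F (t *\<^sub>R a))) (at t)" .
  moreover have "?F (s *\<^sub>R a) = dir_deriv a f (z + t *\<^sub>R a) * s" for s
    using linear_cmul[OF has_derivative_linear[OF F]] by (simp add: dir_deriv_def)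
  ultimately show ?thesis
    by (simp add: has_field_derivative_def)
qed

lemma dir_deriv_linear:
  assumes "C_infinity f"
  shows "linear (\<lambda>v. dir_deriv v f z)"
  unfolding dir_deriv_def
  using C_infinity_differentiable[OF assms] frechet_derivative_works has_derivative_linear by blast

lemma dir_deriv_mean_value:
  assumes "C_infinity f" "h > 0"
  obtains s where "0 < s" "s < h" "f (z + h *\<^sub>R a) - f z = h * dir_deriv a f (z + s *\<^sub>R a)"
proof -
  have "\<exists>s. 0 < s \<and> s < h \<and>
      f (z + h *\<^sub>R a) - f (z + 0 *\<^sub>R a) = (h - 0) * dir_deriv a f (z + s *\<^sub>R a)"
    by (rule MVT2[of 0 h "\<lambda>t. f (z + t *\<^sub>R a)"]) (use assms dir_deriv_line in auto)
  then show ?thesis using that by auto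
qed

lemma second_difference_mean_value:
  assumes f: "C_infinity f" and h: "h > 0"
  obtains s t where "0 < s" "s < h" "0 < t" "t < h"
    "f (z + h *\<^sub>R a + h *\<^sub>R b) - f (z + h *\<^sub>R a) - f (z + h *\<^sub>R b) + f z
      = h^2 * dir_deriv b (dir_deriv a f) (z + s *\<^sub>R a + t *\<^sub>R b)"
proof -
  have "\<exists>s. 0 < s \<and> s < h \<and>
      (f ((z + h *\<^sub>R b) + h *\<^sub>R a) - f (z + h *\<^sub>R a)) - (f ((z + h *\<^sub>R b) + 0 *\<^sub>R a) - f (z + 0 *\<^sub>R a))
       = (h - 0) * (dir_deriv a f ((z + h *\<^sub>R b) + s *\<^sub>R a) - dir_deriv a f (z + s *\<^sub>R a))"
    by (rule MVT2[of 0 h "\<lambda>t. f ((z + h *\<^sub>R b) + t *\<^sub>R a) - f (z + t *\<^sub>R a)"])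
      (use assms dir_deriv_line in \<open>auto intro!: DERIV_diff\<close>)
  then obtain s where s: "0 < s" "s < h"
    and eq: "f (z + h *\<^sub>R a + h *\<^sub>R b) - f (z + h *\<^sub>R a) - f (z + h *\<^sub>R b) + f z
      = h * (dir_deriv a f (z + s *\<^sub>R a + h *\<^sub>R b) - dir_deriv a f (z + s *\<^sub>R a))"
    by (auto simp: algebra_simps)
  obtain t where "0 < t" "t < h"
    "dir_deriv a f (z + s *\<^sub>R a + h *\<^sub>R b) - dir_deriv a f (z + s *\<^sub>R a)
      = h * dir_deriv b (dir_deriv a f) (z + s *\<^sub>R a + t *\<^sub>R b)"
    using dir_deriv_mean_value[OF C_infinity_dir_deriv[OF f] h] by metis
  with s eq show ?thesis by (intro that[of s t]) (auto simp: power2_eq_square)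
qed

text \<open>Both mixed derivatives are limits of the same second difference quotient, by
  \<open>second_difference_mean_value\<close> applied in either order.\<close>

lemma dir_deriv_commute:
  assumes f: "C_infinity f"
  shows "dir_deriv a (dir_deriv b f) = dir_deriv b (dir_deriv a f)"
proof
  fix z
  let ?G = "dir_deriv a (dir_deriv b f)" and ?H = "dir_deriv b (dir_deriv a f)"
  have cont: "isCont ?G z" "isCont ?H z"
    using C_infinity_continuous[OF C_infinity_dir_deriv[OF C_infinity_dir_deriv[OF f]]]
    by (auto simp: continuous_on_eq_continuous_at)
  define h where "h n = inverse (real (Suc n))" for n
  have h: "h n > 0" for n by (simp add: h_def)
  have h0: "h \<longlonglongrightarrow> 0" unfolding h_def by (rule LIMSEQ_inverse_real_of_nat)
  define q where
    "q n = (f (z + h n *\<^sub>R a + h n *\<^sub>R b) - f (z + h n *\<^sub>R a) - f (z + h n *\<^sub>R b) + f z) / (h n)^2" for n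
  have near: "(\<lambda>n. F (z + s n *\<^sub>R x + t n *\<^sub>R y)) \<longlonglongrightarrow> F z"
    if "isCont F z" "\<And>n. 0 < s n \<and> s n < h n \<and> 0 < t n \<and> t n < h n" for F :: "'a \<Rightarrow> real" and s t x y
  proof -
    have "s \<longlonglongrightarrow> 0"
      by (rule tendsto_sandwich[OF _ _ tendsto_const h0]) (use that(2) in \<open>auto intro!: always_eventually less_imp_le\<close>)
    moreover have "t \<longlonglongrightarrow> 0"
      by (rule tendsto_sandwich[OF _ _ tendsto_const h0]) (use that(2) in \<open>auto intro!: always_eventually less_imp_le\<close>)
    ultimately have "(\<lambda>n. z + s n *\<^sub>R x + t n *\<^sub>R y) \<longlonglongrightarrow> z + 0 *\<^sub>R x + 0 *\<^sub>R y"
      by (intro tendsto_intros)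
    then show ?thesis using isCont_tendsto_compose[OF that(1)] by simp
  qed
  have "\<exists>s t. 0 < s \<and> s < h n \<and> 0 < t \<and> t < h n \<and> q n = ?H (z + s *\<^sub>R a + t *\<^sub>R b)" for n
    using second_difference_mean_value[OF f h[of n], where z = z and a = a and b = b] h[of n]
    by (smt (verit) q_def nonzero_mult_div_cancel_left zero_less_power)
  then obtain s t where st: "\<And>n. 0 < s n \<and> s n < h n \<and> 0 < t n \<and> t n < h n"
    "\<And>n. q n = ?H (z + s n *\<^sub>R a + t n *\<^sub>R b)"
    by metis
  have H: "q \<longlonglongrightarrow> ?H z"
    using near[OF cont(2) st(1), of a b] by (simp add: st(2)[symmetric])
  have "\<exists>s t. 0 < s \<and> s < h n \<and> 0 < t \<and> t < h n \<and> q n = ?G (z + s *\<^sub>R b + t *\<^sub>R a)" for n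
  proof -
    have "q n = (f (z + h n *\<^sub>R b + h n *\<^sub>R a) - f (z + h n *\<^sub>R b) - f (z + h n *\<^sub>R a) + f z) / (h n)^2"
      by (simp add: q_def algebra_simps)
    then show ?thesis
      using second_difference_mean_value[OF f h[of n], where z = z and a = b and b = a] h[of n]
      by (smt (verit) nonzero_mult_div_cancel_left zero_less_power)
  qed
  then obtain s t where st: "\<And>n. 0 < s n \<and> s n < h n \<and> 0 < t n \<and> t n < h n"
    "\<And>n. q n = ?G (z + s n *\<^sub>R b + t n *\<^sub>R a)"
    by metis
  have G: "q \<longlonglongrightarrow> ?G z"
    using near[OF cont(1) st(1), of b a] by (simp add: st(2)[symmetric])
  show "?G z = ?H z" using LIMSEQ_unique[OF G H] .
qed

lemma iter_deriv_move:
  assumes "C_infinity f"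
  shows "iter_deriv f (xs @ a # ys) = iter_deriv f (a # xs @ ys)"
  by (induction xs) (auto simp: iter_deriv_Cons dir_deriv_commute C_infinity_iter_deriv assms)

lemma iter_deriv_perm:
  assumes "C_infinity f"
  shows "mset vs = mset ws \<Longrightarrow> iter_deriv f vs = iter_deriv f ws"
proof (induction vs arbitrary: ws)
  case (Cons v vs)
  then have "v \<in> set ws" by (metis list.set_intros(1) mset_eq_setD)
  then obtain xs ys where ws: "ws = xs @ v # ys" by (meson split_list)
  with Cons have "iter_deriv f vs = iter_deriv f (xs @ ys)" by simp
  then show ?case by (simp add: ws iter_deriv_move[OF assms] iter_deriv_Cons)
qed simp

lemma iter_deriv_linear:
  assumes "C_infinity f"
  shows "linear (\<lambda>v. iter_deriv f (v # vs) z)"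
  unfolding iter_deriv_Cons by (rule dir_deriv_linear[OF C_infinity_iter_deriv[OF assms]])

lemma iter_deriv_line:
  assumes "C_infinity f"
  shows "((\<lambda>t. iter_deriv f vs (z + t *\<^sub>R a)) has_real_derivative
           iter_deriv f (a # vs) (z + t *\<^sub>R a)) (at t)"
  unfolding iter_deriv_Cons by (rule dir_deriv_line[OF C_infinity_iter_deriv[OF assms]])

lemma partial_eq_dir_deriv: "C_infinity f \<Longrightarrow> partial b f z = dir_deriv b f z"
  unfolding partial_def using dir_deriv_line[of f z b 0] by (simp add: DERIV_imp_deriv)

section \<open>Derivatives of the logarithm of a determinant\<close>

lemma bounded_bilinear_matrix_mult:
  "bounded_bilinear ((**) :: real^'n^'m \<Rightarrow> real^'p^'n \<Rightarrow> real^'p^'m)"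
  unfolding bilinear_conv_bounded_bilinear[symmetric] bilinear_def
  by (auto intro!: linearI simp: vec_eq_iff matrix_matrix_mult_def sum.distrib sum_distrib_left
      algebra_simps)

lemma bounded_linear_trace: "bounded_linear (trace :: real^'n^'n \<Rightarrow> real)"
  by (auto intro!: linearI simp: linear_conv_bounded_linear[symmetric] trace_def sum.distrib
      sum_distrib_left)

lemmas matrix_mult_has_vector_derivative =
  bounded_bilinear.has_vector_derivative[OF bounded_bilinear_matrix_mult]

lemma matrix_has_vector_derivativeI:
  fixes A :: "real \<Rightarrow> real^'n^'m"
  assumes "\<And>i j. ((\<lambda>t. A t $ i $ j) has_real_derivative A' $ i $ j) (at t)"
  shows "(A has_vector_derivative A') (at t)"
  unfolding has_vector_derivative_def has_derivative_componentwise_within[where f=A]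
  using assms
  by (auto simp: Basis_vec_def inner_axis has_field_derivative_def mult.commute[of _ "A' $ _ $ _"])

lemma has_vector_derivative_matrix_entry:
  fixes A :: "real \<Rightarrow> real^'n^'m"
  assumes "(A has_vector_derivative A') (at t)"
  shows "((\<lambda>t. A t $ i $ j) has_real_derivative A' $ i $ j) (at t)"
proof -
  have "bounded_linear (\<lambda>M::real^'n^'m. M $ i $ j)"
    by (auto intro!: linearI simp: linear_conv_bounded_linear[symmetric])
  from bounded_linear.has_vector_derivative[OF this assms] show ?thesis
    by (simp add: has_real_derivative_iff_has_vector_derivative)
qed

lemma has_vector_derivative_iff_quotient:
  fixes f :: "real \<Rightarrow> 'a::real_normed_vector"
  shows "(f has_vector_derivative f') (at t) \<longleftrightarrow> ((\<lambda>s. (f s - f t) /\<^sub>R (s - t)) \<longlongrightarrow> f') (at t)"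
proof -
  have "norm ((f s - f t) /\<^sub>R (s - t) - f') = norm (f s - f t - (s - t) *\<^sub>R f') / norm (s - t)"
    if "s \<noteq> t" for s
  proof -
    have "(f s - f t) /\<^sub>R (s - t) - f' = (f s - f t - (s - t) *\<^sub>R f') /\<^sub>R (s - t)"
      using that by (simp add: scaleR_diff_right)
    then show ?thesis by (simp add: divide_inverse mult.commute)
  qed
  then have "((\<lambda>s. norm ((f s - f t) /\<^sub>R (s - t) - f')) \<longlongrightarrow> 0) (at t)
      \<longleftrightarrow> ((\<lambda>s. norm (f s - f t - (s - t) *\<^sub>R f') / norm (s - t)) \<longlongrightarrow> 0) (at t)"
    by (intro filterlim_cong refl) (auto simp: eventually_at_filter)
  then show ?thesis
    by (simp add: has_vector_derivative_def has_derivative_iff_norm bounded_linear_scaleR_left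
        tendsto_norm_zero_iff LIM_zero_iff)
qed

text \<open>From \<open>B s - B t = - B s (A s - A t) B t\<close>: boundedness of \<open>B\<close> makes \<open>B\<close> continuous, and
  continuity makes the difference quotient converge.\<close>

lemma matrix_inverse_has_vector_derivative:
  fixes A B :: "real \<Rightarrow> real^'n^'n"
  assumes A: "(A has_vector_derivative A') (at t)"
    and inv: "\<And>s. A s ** B s = mat 1" "\<And>s. B s ** A s = mat 1"
    and bdd: "\<And>s. norm (B s) \<le> K"
  shows "(B has_vector_derivative - (B t ** A' ** B t)) (at t)"
proof -
  interpret mm: bounded_bilinear "(**) :: real^'n^'n \<Rightarrow> real^'n^'n \<Rightarrow> real^'n^'n"
    by (rule bounded_bilinear_matrix_mult)
  have diff: "B s - B t = - (B s ** (A s - A t) ** B t)" for s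
    by (simp add: mm.diff_left mm.diff_right inv matrix_mul_assoc[symmetric])
  have "isCont A t" using has_vector_derivative_continuous[OF A] .
  then have "Zfun (\<lambda>s. A s - A t) (at t)"
    by (simp add: isCont_def tendsto_Zfun_iff)
  moreover have "Bfun B (at t)"
    using bdd by (auto simp: Bfun_def intro!: always_eventually exI[of _ "max K 1"] max.coboundedI1)
  ultimately have "Zfun (\<lambda>s. - (B s ** (A s - A t) ** B t)) (at t)"
    by (intro Zfun_minus mm.Zfun_left mm.Bfun_prod_Zfun)
  then have "(B \<longlongrightarrow> B t) (at t)"
    by (simp add: tendsto_Zfun_iff diff)
  moreover have "((\<lambda>s. (A s - A t) /\<^sub>R (s - t)) \<longlongrightarrow> A') (at t)"
    using A by (simp add: has_vector_derivative_iff_quotient)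
  ultimately have "((\<lambda>s. - (B s ** ((A s - A t) /\<^sub>R (s - t)) ** B t)) \<longlongrightarrow> - (B t ** A' ** B t)) (at t)"
    by (intro tendsto_minus mm.tendsto tendsto_const)
  then show ?thesis
    unfolding has_vector_derivative_iff_quotient
    by (simp add: diff mm.scaleR_left mm.scaleR_right)
qed

lemma det_has_derivative_at_identity:
  fixes A :: "real \<Rightarrow> real^'n^'n"
  assumes A: "(A has_vector_derivative A') (at t)" and I: "A t = mat 1"
  shows "((\<lambda>s. det (A s)) has_real_derivative trace A') (at t)"
proof -
  have "((\<lambda>s. det (A s)) has_real_derivative
     (\<Sum>p\<in>{p. p permutes UNIV}. of_int (sign p) *
       (\<Sum>i\<in>UNIV. A' $ i $ p i * (\<Prod>j\<in>UNIV - {i}. A t $ j $ p j)))) (at t)"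
    unfolding det_def
    by (intro DERIV_sum DERIV_cmult has_field_derivative_prod has_vector_derivative_matrix_entry[OF A])
  also have "(\<Sum>p\<in>{p. p permutes UNIV}. of_int (sign p) *
       (\<Sum>i\<in>UNIV. A' $ i $ p i * (\<Prod>j\<in>UNIV - {i}. A t $ j $ p j)))
     = (\<Sum>p\<in>{p. p permutes (UNIV::'n set)}. if p = id then trace A' else 0)"
  proof (rule sum.cong)
    fix p :: "'n \<Rightarrow> 'n" assume "p \<in> {p. p permutes UNIV}"
    then have p: "p permutes UNIV" by simp
    have zero: "(\<Prod>j\<in>UNIV - {i}. A t $ j $ p j) = 0" if "p \<noteq> id" for i
    proof -
      \<comment> \<open>A permutation fixing every index but one is the identity.\<close>
      have "\<exists>j. j \<noteq> i \<and> p j \<noteq> j"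
      proof (rule ccontr)
        assume "\<not> (\<exists>j. j \<noteq> i \<and> p j \<noteq> j)"
        then have fixed: "\<And>j. j \<noteq> i \<Longrightarrow> p j = j" by blast
        then have "p i = i" using p by (metis permutes_univ)
        then show False using fixed that by (metis eq_id_iff)
      qed
      then obtain j where "j \<noteq> i" "p j \<noteq> j" by blast
      then show ?thesis by (intro prod_zero) (auto simp: I mat_def intro!: bexI[of _ j])
    qed
    show "of_int (sign p) * (\<Sum>i\<in>UNIV. A' $ i $ p i * (\<Prod>j\<in>UNIV - {i}. A t $ j $ p j))
        = (if p = id then trace A' else 0)"
    proof (cases "p = id")
      case True
      then show ?thesis by (simp add: I mat_def trace_def sign_id)
    next
      case False
      then show ?thesis by (simp only: zero[OF False]) simp
    qed
  qed simp
  also have "\<dots> = trace A'"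
    by (simp add: permutes_id)
  finally show ?thesis .
qed

text \<open>Multiplying the curve by the inverse of its value at \<open>t\<close> reduces Jacobi's formula to the
  derivative at the identity. Determinants of either sign are covered, as \<open>ln x = ln (- x)\<close> for
  real arguments.\<close>

lemma ln_det_has_derivative:
  fixes A :: "real \<Rightarrow> real^'n^'n"
  assumes A: "(A has_vector_derivative A') (at t)" and inv: "A t ** B = mat 1" "B ** A t = mat 1"
  shows "((\<lambda>s. ln (det (A s))) has_real_derivative trace (B ** A')) (at t)"
proof -
  have d: "det (A t) * det B = 1" using inv(1) det_mul det_I by metis
  have "((\<lambda>s. B ** A s) has_vector_derivative B ** A') (at t)"
    using matrix_mult_has_vector_derivative[OF has_vector_derivative_const A] by simp
  then have "((\<lambda>s. det (B ** A s)) has_real_derivative trace (B ** A')) (at t)"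
    using inv by (intro det_has_derivative_at_identity)
  from DERIV_cmult[OF this, of "det (A t)"]
  have det: "((\<lambda>s. det (A s)) has_real_derivative det (A t) * trace (B ** A')) (at t)"
    using d by (simp add: det_mul mult.assoc[symmetric])
  have ln: "(ln has_real_derivative 1 / x) (at x)" if "x \<noteq> 0" for x :: real
  proof (cases "x > 0")
    case False
    with that have "((\<lambda>y. ln (- y)) has_real_derivative 1 / x) (at x)"
      by (auto intro!: derivative_eq_intros simp: divide_simps)
    then show ?thesis by (simp add: ln_minus)
  qed (rule DERIV_ln_divide)
  have "det (A t) \<noteq> 0" using d by auto
  from DERIV_chain2[OF ln[OF this] det] this show ?thesis by simp
qed

text \<open>A uniform lower bound on the quadratic form gives \<open>c |v| \<le> |A t v|\<close>, so the inverses exist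
  and are bounded by \<open>1 / c\<close>.\<close>

lemma matrix_bounded_inverse:
  fixes A :: "real \<Rightarrow> real^'n^'n"
  assumes c: "c > 0" and pd: "\<And>t v. c * (v \<bullet> v) \<le> v \<bullet> (A t *v v)"
  obtains B K where "\<And>t. A t ** B t = mat 1" "\<And>t. B t ** A t = mat 1" "\<And>t. norm (B t) \<le> K"
proof -
  have lower: "c * norm v \<le> norm (A t *v v)" for t v
  proof (cases "v = 0")
    case False
    have "c * (norm v)^2 \<le> norm v * norm (A t *v v)"
      using pd[of v t] norm_cauchy_schwarz[of v "A t *v v"] by (simp add: power2_norm_eq_inner)
    then show ?thesis using False by (simp add: power2_eq_square mult.left_commute)
  qed simp
  have "v = 0" if "A t *v v = 0" for t v
    using lower[of v t] that c by (simp add: mult_le_0_iff)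
  then have inv: "invertible (A t)" for t
    by (simp add: invertible_left_inverse matrix_left_invertible_ker)
  then have "\<forall>t. \<exists>B. A t ** B = mat 1 \<and> B ** A t = mat 1"
    by (simp add: invertible_def)
  then obtain B where B: "\<And>t. A t ** B t = mat 1" "\<And>t. B t ** A t = mat 1"
    by metis
  have entry: "\<bar>B t $ i $ j\<bar> \<le> 1 / c" for t i j
  proof -
    have "c * norm (B t *v axis j 1) \<le> norm (A t *v (B t *v axis j 1))" by (rule lower)
    also have "\<dots> = 1" by (simp add: matrix_vector_mul_assoc B)
    finally have "norm (B t *v axis j 1) \<le> 1 / c" using c by (simp add: field_simps)
    moreover have "\<bar>(B t *v axis j 1) $ i\<bar> \<le> norm (B t *v axis j 1)" by (rule component_le_norm_cart)
    moreover have "(B t *v axis j 1) $ i = B t $ i $ j"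
      by (simp add: matrix_vector_mul_component inner_axis)
    ultimately show ?thesis by simp
  qed
  have "norm (B t) \<le> (\<Sum>i\<in>(UNIV::'n set). \<Sum>j\<in>(UNIV::'n set). 1 / c)" for t
  proof -
    have "norm (B t) \<le> (\<Sum>i\<in>UNIV. norm (B t $ i))" unfolding norm_vec_def by (simp add: L2_set_le_sum)
    also have "\<dots> \<le> (\<Sum>i\<in>(UNIV::'n set). \<Sum>j\<in>(UNIV::'n set). 1 / c)"
      by (intro sum_mono order_trans[OF norm_le_l1_cart] entry)
    finally show ?thesis .
  qed
  then show ?thesis by (intro that[of B]) (use B in auto)
qed

text \<open>For a curve of matrices with inverse \<open>B\<close>, the derivative of \<open>ln det A\<close> is
  \<open>tr (B A')\<close>, and \<open>B' = - B A' B\<close>; where \<open>A\<close> is the identity the second and third derivatives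
  then only involve traces of products of the derivatives of \<open>A\<close>.\<close>

lemma ln_det_derivatives:
  fixes A A1 A2 A3 :: "real \<Rightarrow> real^'n^'n"
  assumes c: "c > 0" and pd: "\<And>t v. c * (v \<bullet> v) \<le> v \<bullet> (A t *v v)"
    and A: "\<And>t. (A has_vector_derivative A1 t) (at t)"
    and A1: "\<And>t. (A1 has_vector_derivative A2 t) (at t)"
    and A2: "\<And>t. (A2 has_vector_derivative A3 t) (at t)"
    and I: "A 0 = mat 1"
  obtains G1 G2 where "\<And>t. ((\<lambda>s. ln (det (A s))) has_real_derivative G1 t) (at t)"
    "\<And>t. (G1 has_real_derivative G2 t) (at t)"
    "G2 0 = trace (A2 0) - trace (A1 0 ** A1 0)"
    "(G2 has_real_derivative
        trace (A3 0) - 3 * trace (A1 0 ** A2 0) + 2 * trace (A1 0 ** A1 0 ** A1 0)) (at 0)"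
proof -
  interpret mm: bounded_bilinear "(**) :: real^'n^'n \<Rightarrow> real^'n^'n \<Rightarrow> real^'n^'n"
    by (rule bounded_bilinear_matrix_mult)
  interpret tr: bounded_linear "trace :: real^'n^'n \<Rightarrow> real"
    by (rule bounded_linear_trace)
  obtain B K where inv: "\<And>t. A t ** B t = mat 1" "\<And>t. B t ** A t = mat 1" and K: "\<And>t. norm (B t) \<le> K"
    using matrix_bounded_inverse[OF c, of A] pd by metis
  have B: "(B has_vector_derivative - (B t ** A1 t ** B t)) (at t)" for t
    by (rule matrix_inverse_has_vector_derivative[OF A inv K])
  have B0: "B 0 = mat 1" using inv(1)[of 0] I by simp
  define G1 where "G1 t = trace (B t ** A1 t)" for t
  define G2 where "G2 t = trace (B t ** A2 t - B t ** A1 t ** B t ** A1 t)" for t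
  have "((\<lambda>s. ln (det (A s))) has_real_derivative G1 t) (at t)" for t
    unfolding G1_def by (rule ln_det_has_derivative[OF A inv])
  moreover have "(G1 has_real_derivative G2 t) (at t)" for t
    unfolding has_real_derivative_iff_has_vector_derivative G1_def[abs_def]
    by (rule has_vector_derivative_eq_rhs[OF
          tr.has_vector_derivative[OF mm.has_vector_derivative[OF B A1]]])
      (simp add: G2_def mm.minus_left)
  moreover have "G2 0 = trace (A2 0) - trace (A1 0 ** A1 0)"
    by (simp add: G2_def B0 tr.diff)
  moreover have "(G2 has_real_derivative
        trace (A3 0) - 3 * trace (A1 0 ** A2 0) + 2 * trace (A1 0 ** A1 0 ** A1 0)) (at 0)"
  proof -
    have cyc: "trace (A2 0 ** A1 0) = trace (A1 0 ** A2 0)" by (rule trace_mul_sym)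
    have double: "trace (2 * M) = 2 * trace M" "(X - 2 * M) ** N = X ** N - 2 * (M ** N)"
      for M N X :: "real^'n^'n"
      by (simp_all only: mult_2 tr.add mm.diff_left mm.add_left)
    show ?thesis
      unfolding has_real_derivative_iff_has_vector_derivative G2_def[abs_def]
      by (rule has_vector_derivative_eq_rhs[OF
            tr.has_vector_derivative[OF has_vector_derivative_diff[OF mm.has_vector_derivative[OF B A2]
              mm.has_vector_derivative[OF mm.has_vector_derivative[OF mm.has_vector_derivative[OF B A1] B] A1]]]])
        (simp add: B0 mm.minus_left mm.minus_right mm.add_left tr.add tr.diff linear_neg[OF tr.linear_axioms] cyc double)
  qed
  ultimately show ?thesis by (rule that)
qed

lemma ln_det_equation_derivatives:
  fixes A A1 A2 A3 :: "real \<Rightarrow> real^'n^'n" and C C1 C2 C3 :: "real \<Rightarrow> real^'m^'m"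
  assumes c: "c > 0" "\<And>t v. c * (v \<bullet> v) \<le> v \<bullet> (A t *v v)" "\<And>t v. c * (v \<bullet> v) \<le> v \<bullet> (C t *v v)"
    and A: "\<And>t. (A has_vector_derivative A1 t) (at t)" "\<And>t. (A1 has_vector_derivative A2 t) (at t)"
      "\<And>t. (A2 has_vector_derivative A3 t) (at t)" "A 0 = mat 1"
    and C: "\<And>t. (C has_vector_derivative C1 t) (at t)" "\<And>t. (C1 has_vector_derivative C2 t) (at t)"
      "\<And>t. (C2 has_vector_derivative C3 t) (at t)" "C 0 = mat 1"
    and eq: "\<And>t. ln (det (A t)) - ln (det (C t)) = k"
  shows "trace (A2 0) - trace (A1 0 ** A1 0) = trace (C2 0) - trace (C1 0 ** C1 0)"
    and "trace (A3 0) - 3 * trace (A1 0 ** A2 0) + 2 * trace (A1 0 ** A1 0 ** A1 0)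
       = trace (C3 0) - 3 * trace (C1 0 ** C2 0) + 2 * trace (C1 0 ** C1 0 ** C1 0)"
proof -
  obtain G1 G2 where G: "\<And>t. ((\<lambda>s. ln (det (A s))) has_real_derivative G1 t) (at t)"
    "\<And>t. (G1 has_real_derivative G2 t) (at t)"
    "G2 0 = trace (A2 0) - trace (A1 0 ** A1 0)"
    "(G2 has_real_derivative
        trace (A3 0) - 3 * trace (A1 0 ** A2 0) + 2 * trace (A1 0 ** A1 0 ** A1 0)) (at 0)"
    using ln_det_derivatives[OF c(1) c(2) A] by blast
  obtain H1 H2 where H: "\<And>t. ((\<lambda>s. ln (det (C s))) has_real_derivative H1 t) (at t)"
    "\<And>t. (H1 has_real_derivative H2 t) (at t)"
    "H2 0 = trace (C2 0) - trace (C1 0 ** C1 0)"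
    "(H2 has_real_derivative
        trace (C3 0) - 3 * trace (C1 0 ** C2 0) + 2 * trace (C1 0 ** C1 0 ** C1 0)) (at 0)"
    using ln_det_derivatives[OF c(1) c(3) C] by blast
  have shift: "(\<lambda>s. ln (det (A s))) = (\<lambda>s. ln (det (C s)) + k)"
    using eq by (auto simp: algebra_simps)
  have "G1 t = H1 t" for t
    using DERIV_unique[OF G(1)[of t, unfolded shift]] DERIV_add[OF H(1)[of t] DERIV_const, of k] by simp
  then have 1: "G1 = H1" by blast
  have "G2 t = H2 t" for t
    using DERIV_unique[OF G(2)[of t, unfolded 1] H(2)] .
  then have 2: "G2 = H2" by blast
  show "trace (A2 0) - trace (A1 0 ** A1 0) = trace (C2 0) - trace (C1 0 ** C1 0)"
    using G(3) H(3) 2 by simp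
  show "trace (A3 0) - 3 * trace (A1 0 ** A2 0) + 2 * trace (A1 0 ** A1 0 ** A1 0)
       = trace (C3 0) - 3 * trace (C1 0 ** C2 0) + 2 * trace (C1 0 ** C1 0 ** C1 0)"
    using DERIV_unique[OF G(4)[unfolded 2] H(4)] .
qed

section \<open>Orthonormal frames\<close>

text \<open>Gram-Schmidt for the form \<open>b\<close>, applied to the coordinate axes. That the \<open>f i\<close> live on the
  coordinates already treated shows that the next axis is not in their span.\<close>

lemma gram_schmidt_coordinates:
  fixes b :: "real^'n \<Rightarrow> real^'n \<Rightarrow> real"
  assumes b: "bilinear b" and sym: "\<And>v w. b v w = b w v" and pos: "\<And>v. v \<noteq> 0 \<Longrightarrow> b v v > 0"
    and "finite S"
  shows "\<exists>f. (\<forall>i\<in>S. \<forall>j\<in>S. b (f i) (f j) = (if i = j then 1 else 0)) \<and> (\<forall>i\<in>S. \<forall>m. m \<notin> S \<longrightarrow> f i $ m = 0)"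
  using \<open>finite S\<close>
proof (induction S)
  case (insert x S)
  then obtain f where f: "\<And>i j. i \<in> S \<Longrightarrow> j \<in> S \<Longrightarrow> b (f i) (f j) = (if i = j then 1 else 0)"
    and supp: "\<And>i m. i \<in> S \<Longrightarrow> m \<notin> S \<Longrightarrow> f i $ m = 0" by blast
  define w where "w = axis x 1 - (\<Sum>j\<in>S. b (f j) (axis x 1) *\<^sub>R f j)"
  have lin: "linear (b v)" for v using b by (simp add: bilinear_def)
  have orth: "b (f i) w = 0" if "i \<in> S" for i
  proof -
    have "b (f i) w = b (f i) (axis x 1) - (\<Sum>j\<in>S. b (f j) (axis x 1) * b (f i) (f j))"
      by (simp add: w_def linear_diff[OF lin] linear_sum[OF lin] linear_cmul[OF lin])
    also have "(\<Sum>j\<in>S. b (f j) (axis x 1) * b (f i) (f j)) = (\<Sum>j\<in>S. if i = j then b (f j) (axis x 1) else 0)"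
      by (intro sum.cong) (use f that in auto)
    finally show ?thesis using that insert.hyps by simp
  qed
  have wx: "w $ x = 1" using supp insert.hyps by (simp add: w_def)
  have wm: "w $ m = 0" if "m \<notin> insert x S" for m
    using supp that by (simp add: w_def axis_def)
  have "w \<noteq> 0" using wx by auto
  then have pw: "b w w > 0" by (rule pos)
  define v where "v = (1 / sqrt (b w w)) *\<^sub>R w"
  have "b v v = 1"
    using pw by (simp add: v_def bilinear_lmul[OF b] bilinear_rmul[OF b] real_sqrt_mult_self field_simps)
  moreover have "b (f i) v = 0" "b v (f i) = 0" if "i \<in> S" for i
    using orth[OF that] sym by (simp_all add: v_def bilinear_rmul[OF b])
  moreover have "v $ m = 0" if "m \<notin> insert x S" for m
    using wm[OF that] by (simp add: v_def)
  ultimately show ?case using f supp insert.hyps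
    by (intro exI[of _ "f(x := v)"]) auto
qed simp

text \<open>An orthonormal family of full size is a basis: the matrix of its coordinates has a left inverse
  read off from \<open>b\<close>, hence a two-sided one, which is the expansion formula.\<close>

lemma orthonormal_family:
  fixes b :: "real^'n \<Rightarrow> real^'n \<Rightarrow> real"
  assumes b: "bilinear b" and sym: "\<And>v w. b v w = b w v" and pos: "\<And>v. v \<noteq> 0 \<Longrightarrow> b v v > 0"
  shows "\<exists>f :: 'n \<Rightarrow> real^'n. (\<forall>i j. b (f i) (f j) = (if i = j then 1 else 0)) \<and>
    (\<forall>v. v = (\<Sum>i\<in>UNIV. b (f i) v *\<^sub>R f i))"
proof -
  obtain f :: "'n \<Rightarrow> real^'n" where f: "\<And>i j. b (f i) (f j) = (if i = j then 1 else 0)"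
    using gram_schmidt_coordinates[of b UNIV, OF b sym] pos by auto
  have lin: "linear (b v)" for v using b by (simp add: bilinear_def)
  define P where "P = (\<chi> i j. f j $ i)"
  define M where "M = (\<chi> i j. b (f i) (axis j 1))"
  have Mv: "(M *v v) $ i = b (f i) v" for v i
  proof -
    have "b (f i) v = b (f i) (\<Sum>j\<in>UNIV. v $ j *\<^sub>R axis j 1)"
      using basis_expansion[of v] by (simp add: scalar_mult_eq_scaleR)
    then show ?thesis
      by (simp add: linear_sum[OF lin] linear_cmul[OF lin] M_def matrix_vector_mult_def mult.commute)
  qed
  have col: "P *v axis j 1 = f j" for j by (simp add: matrix_vector_mul_component vec_eq_iff inner_axis P_def)
  have "(M ** P) $ i $ j = mat 1 $ i $ j" for i j
  proof -
    have "(M ** P) $ i $ j = ((M ** P) *v axis j 1) $ i"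
      by (simp add: matrix_vector_mul_component inner_axis)
    also have "\<dots> = b (f i) (f j)" by (simp add: matrix_vector_mul_assoc[symmetric] Mv col)
    finally show ?thesis by (simp add: f mat_def)
  qed
  then have "M ** P = mat 1" by (simp add: vec_eq_iff)
  then have PM: "P ** M = mat 1" by (simp add: matrix_left_right_inverse)
  have "v = (\<Sum>i\<in>UNIV. b (f i) v *\<^sub>R f i)" for v
  proof -
    have "v = P *v (M *v v)" by (simp add: matrix_vector_mul_assoc PM)
    also have "\<dots> = (\<Sum>i\<in>UNIV. b (f i) v *\<^sub>R f i)"
      unfolding vec_eq_iff matrix_vector_mult_def[of P] by (simp add: Mv P_def mult.commute)
    finally show ?thesis .
  qed
  then show ?thesis using f by (intro exI[of _ f] conjI allI)
qed

section \<open>The metric\<close>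

definition proj_x :: "'a::real_vector \<times> 'b::real_vector \<Rightarrow> 'a \<times> 'b" where "proj_x v = (fst v, 0)"
definition proj_y :: "'a::real_vector \<times> 'b::real_vector \<Rightarrow> 'a \<times> 'b" where "proj_y v = (0, snd v)"

lemma linear_proj_x: "linear proj_x" and linear_proj_y: "linear proj_y"
  by (auto intro!: linearI simp: proj_x_def proj_y_def)

text \<open>The two Hessian blocks enter the equation with opposite signs. Weights built from this sign
  express sums over one block only: \<open>(s a + s b) / 2\<close> is \<open>1\<close> or \<open>- 1\<close> if \<open>a\<close> and \<open>b\<close> lie in the same
  block and \<open>0\<close> otherwise, and \<open>1 + s a s b + s b s c + s a s c\<close> is \<open>4\<close> if all three lie in the same
  block and \<open>0\<close> otherwise.\<close>

definition block_sign :: "'k + 'l \<Rightarrow> real" where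
  "block_sign = case_sum (\<lambda>_. 1) (\<lambda>_. -1)"

lemma block_sign_simps [simp]: "block_sign (Inl i) = 1" "block_sign (Inr j) = -1"
  by (simp_all add: block_sign_def)

lemma sum_UNIV_Plus:
  fixes F :: "'k::finite + 'l::finite \<Rightarrow> real"
  shows "(\<Sum>a\<in>UNIV. F a) = (\<Sum>i\<in>UNIV. F (Inl i)) + (\<Sum>j\<in>UNIV. F (Inr j))"
  by (simp add: UNIV_Plus_UNIV[symmetric] sum.Plus del: UNIV_Plus_UNIV)

lemma inner_matrix_eq_bilinear:
  fixes b :: "real^'n \<Rightarrow> real^'n \<Rightarrow> real"
  assumes b: "bilinear b"
  shows "v \<bullet> ((\<chi> i j. b (f i) (f j)) *v w) = b (\<Sum>i\<in>UNIV. v $ i *\<^sub>R f i) (\<Sum>j\<in>UNIV. w $ j *\<^sub>R f j)"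
  unfolding bilinear_sum[OF b] sum.cartesian_product[symmetric]
  by (simp add: inner_vec_def matrix_vector_mult_def bilinear_lmul[OF b] bilinear_rmul[OF b]
      sum_distrib_left mult.assoc mult.left_commute mult.commute)

lemma congruence_entry:
  fixes P :: "real^'n^'m" and H :: "real^'n^'n"
  shows "(P ** H ** transpose P) $ i $ j = P $ i \<bullet> (H *v P $ j)"
proof -
  have "transpose P *v axis j 1 = P $ j"
    by (simp add: vec_eq_iff matrix_vector_mul_component inner_axis transpose_def)
  moreover have "(P ** H ** transpose P) $ i $ j = ((P ** H ** transpose P) *v axis j 1) $ i"
    by (simp add: matrix_vector_mul_component inner_axis)
  ultimately show ?thesis
    by (simp add: matrix_vector_mul_assoc[symmetric] matrix_vector_mul_component[of P])
qed

lemma trace_cube: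
  "trace (X ** X ** X) = (\<Sum>i\<in>UNIV. \<Sum>j\<in>UNIV. \<Sum>m\<in>UNIV. X $ i $ j * X $ j $ m * X $ m $ i)"
  for X :: "real^'n^'n"
proof -
  have "trace (X ** X ** X) = (\<Sum>i\<in>UNIV. \<Sum>m\<in>UNIV. \<Sum>j\<in>UNIV. X $ i $ j * X $ j $ m * X $ m $ i)"
    by (simp add: trace_def matrix_matrix_mult_def sum_distrib_right)
  also have "\<dots> = (\<Sum>i\<in>UNIV. \<Sum>j\<in>UNIV. \<Sum>m\<in>UNIV. X $ i $ j * X $ j $ m * X $ m $ i)"
    by (rule sum.cong[OF refl], rule sum.swap)
  finally show ?thesis .
qed

locale saddle_solution =
  fixes u :: "(real^'k) \<times> (real^'l) \<Rightarrow> real" and lam Lam :: real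
  assumes lam: "lam > 0" and Lam: "Lam > 0" and smooth: "C_infinity u"
    and lower_x: "\<And>z. matrix_le (lam *\<^sub>R mat 1) (hess_x u z)"
    and upper_x: "\<And>z. matrix_le (hess_x u z) (Lam *\<^sub>R mat 1)"
    and lower_y: "\<And>z. matrix_le (lam *\<^sub>R mat 1) (- hess_y u z)"
    and upper_y: "\<And>z. matrix_le (- hess_y u z) (Lam *\<^sub>R mat 1)"
    and equation: "\<And>z. ln (det (hess_x u z)) - ln (det (- hess_y u z)) = 0"
begin

text \<open>\<open>D [v\<^sub>1, \<dots>, v\<^sub>m] z\<close> is the value of the symmetric multilinear form \<open>D\<^sup>mu(z)\<close>.\<close>

abbreviation D :: "((real^'k) \<times> (real^'l)) list \<Rightarrow> (real^'k) \<times> (real^'l) \<Rightarrow> real" where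
  "D \<equiv> iter_deriv u"

lemma D_perm: "mset vs = mset ws \<Longrightarrow> D vs z = D ws z"
  using iter_deriv_perm[OF smooth] by metis

lemma D_linear: "linear (\<lambda>v. D (v # vs) z)"
  by (rule iter_deriv_linear[OF smooth])

lemma D_linear2: "linear (\<lambda>v. D (a # v # vs) z)"
  using D_linear[of "a # vs" z] D_perm[of "a # v # vs" "v # a # vs" z for v] by simp

lemma D_linear3: "linear (\<lambda>v. D (a # b # v # vs) z)"
  using D_linear[of "a # b # vs" z] D_perm[of "a # b # v # vs" "v # a # b # vs" z for v] by simp

lemma D_line: "((\<lambda>t. D vs (z + t *\<^sub>R a)) has_real_derivative D (a # vs) (z + t *\<^sub>R a)) (at t)"
  by (rule iter_deriv_line[OF smooth])

lemma D_continuous: "continuous_on UNIV (D vs)"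
  by (rule C_infinity_continuous[OF C_infinity_iter_deriv[OF smooth]])

lemma bilinear_x: "bilinear (\<lambda>v w. D ((v, 0) # (w, 0) # vs) z)"
  and bilinear_y: "bilinear (\<lambda>v w. D ((0, v) # (0, w) # vs) z)"
proof -
  have 1: "linear (\<lambda>v. (v, 0) :: (real^'k) \<times> (real^'l))" and 2: "linear (\<lambda>v. (0, v) :: (real^'k) \<times> (real^'l))"
    by (auto intro!: linearI)
  show "bilinear (\<lambda>v w. D ((v, 0) # (w, 0) # vs) z)" "bilinear (\<lambda>v w. D ((0, v) # (0, w) # vs) z)"
    unfolding bilinear_def
    using linear_compose[OF 1 D_linear] linear_compose[OF 1 D_linear2]
      linear_compose[OF 2 D_linear] linear_compose[OF 2 D_linear2] by (simp_all add: o_def)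
qed

lemma hess_x_eq: "hess_x u z = (\<chi> i j. D [(axis i 1, 0), (axis j 1, 0)] z)"
proof -
  have p: "partial a u = dir_deriv a u" for a
    using partial_eq_dir_deriv[OF smooth] by blast
  show ?thesis
    unfolding hess_x_def p vec_eq_iff
    by (simp add: partial_eq_dir_deriv[OF C_infinity_dir_deriv[OF smooth]] iter_deriv_Cons
        dir_deriv_commute[OF smooth])
qed

lemma hess_y_eq: "hess_y u z = (\<chi> i j. D [(0, axis i 1), (0, axis j 1)] z)"
proof -
  have p: "partial a u = dir_deriv a u" for a
    using partial_eq_dir_deriv[OF smooth] by blast
  show ?thesis
    unfolding hess_y_def p vec_eq_iff
    by (simp add: partial_eq_dir_deriv[OF C_infinity_dir_deriv[OF smooth]] iter_deriv_Cons
        dir_deriv_commute[OF smooth])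
qed

lemma inner_hess_x: "v \<bullet> (hess_x u z *v w) = D [(v, 0), (w, 0)] z"
  unfolding hess_x_eq using inner_matrix_eq_bilinear[OF bilinear_x[of "[]" z], of v "\<lambda>i. axis i 1" w]
  by (simp add: basis_expansion[of v, unfolded scalar_mult_eq_scaleR] basis_expansion[of w, unfolded scalar_mult_eq_scaleR])

lemma inner_hess_y: "v \<bullet> (hess_y u z *v w) = D [(0, v), (0, w)] z"
  unfolding hess_y_eq using inner_matrix_eq_bilinear[OF bilinear_y[of "[]" z], of v "\<lambda>i. axis i 1" w]
  by (simp add: basis_expansion[of v, unfolded scalar_mult_eq_scaleR] basis_expansion[of w, unfolded scalar_mult_eq_scaleR])

lemma D_x_bounds: "lam * (v \<bullet> v) \<le> D [(v, 0), (v, 0)] z" "D [(v, 0), (v, 0)] z \<le> Lam * (v \<bullet> v)"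
  using lower_x[of z] upper_x[of z]
  by (simp_all add: matrix_le_def matrix_vector_mult_diff_rdistrib inner_diff_right inner_hess_x
      scaleR_matrix_vector_assoc[symmetric])

lemma D_y_bounds: "lam * (v \<bullet> v) \<le> - D [(0, v), (0, v)] z" "- D [(0, v), (0, v)] z \<le> Lam * (v \<bullet> v)"
proof -
  have "- hess_y u z *v v = - (hess_y u z *v v)"
    by (metis diff_0 matrix_vector_mult_0 matrix_vector_mult_diff_rdistrib)
  then show "lam * (v \<bullet> v) \<le> - D [(0, v), (0, v)] z" "- D [(0, v), (0, v)] z \<le> Lam * (v \<bullet> v)"
    using lower_y[of z, unfolded matrix_le_def, rule_format, of v]
      upper_y[of z, unfolded matrix_le_def, rule_format, of v]
    by (simp_all only: matrix_vector_mult_diff_rdistrib inner_diff_right inner_minus_right inner_hess_y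
      scaleR_matrix_vector_assoc[symmetric] inner_scaleR_right matrix_vector_mul_lid diff_ge_0_iff_ge)
qed

text \<open>Under the partial Legendre transform in \<open>y\<close> this is the Hessian metric of the transformed
  function. It is built from the pure blocks of the Hessian of \<open>u\<close>, and hence controlled by \<open>lam\<close>.\<close>

definition metric :: "(real^'k) \<times> (real^'l) \<Rightarrow> (real^'k) \<times> (real^'l) \<Rightarrow> (real^'k) \<times> (real^'l) \<Rightarrow> real" where
  "metric z v w = D [proj_x v, proj_x w] z - D [proj_y v, proj_y w] z"

lemma bilinear_metric: "bilinear (metric z)"
  unfolding bilinear_def metric_def
  by (intro conjI allI linear_compose_sub linear_compose[unfolded o_def, OF linear_proj_x D_linear]
      linear_compose[unfolded o_def, OF linear_proj_x D_linear2]
      linear_compose[unfolded o_def, OF linear_proj_y D_linear]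
      linear_compose[unfolded o_def, OF linear_proj_y D_linear2])

lemma metric_commute: "metric z v w = metric z w v"
  unfolding metric_def
  using D_perm[of "[proj_x v, proj_x w]" "[proj_x w, proj_x v]"]
    D_perm[of "[proj_y v, proj_y w]" "[proj_y w, proj_y v]"] by (simp add: add_mset_commute)

lemma metric_lower: "lam * (v \<bullet> v) \<le> metric z v v"
  using D_x_bounds(1)[of "fst v" z] D_y_bounds(1)[of "snd v" z]
  by (simp add: metric_def proj_x_def proj_y_def inner_prod_def algebra_simps)

text \<open>The frame vectors lie in the two factors, so that \<open>metric\<close> and the two Hessian blocks are
  normalised simultaneously.\<close>

definition frame :: "(real^'k) \<times> (real^'l) \<Rightarrow> ('k + 'l \<Rightarrow> (real^'k) \<times> (real^'l)) \<Rightarrow> bool" where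
  "frame z E \<longleftrightarrow> (\<forall>i. snd (E (Inl i)) = 0) \<and> (\<forall>j. fst (E (Inr j)) = 0) \<and>
     (\<forall>a b. metric z (E a) (E b) = (if a = b then 1 else 0)) \<and>
     (\<forall>v. v = (\<Sum>a\<in>UNIV. metric z (E a) v *\<^sub>R E a))"

lemma frame_exists: obtains E where "frame z E"
proof -
  let ?b = "\<lambda>v w. D [(v, 0), (w, 0)] z" and ?c = "\<lambda>v w. - D [(0, v), (0, w)] z"
  have b: "?b v w = ?b w v" for v w by (rule D_perm) simp
  have c: "?c v w = ?c w v" for v w using D_perm[of "[(0, v), (0, w)]" "[(0, w), (0, v)]"] by simp
  have bp: "?b v v > 0" if "v \<noteq> 0" for v
  proof -
    have "lam * (v \<bullet> v) > 0" using lam that by simp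
    then show ?thesis using D_x_bounds(1)[of v z] by linarith
  qed
  have cp: "?c v v > 0" if "v \<noteq> 0" for v
  proof -
    have "lam * (v \<bullet> v) > 0" using lam that by simp
    then show ?thesis using D_y_bounds(1)[of v z] by linarith
  qed
  have c_bil: "bilinear ?c"
    using bilinear_y[of "[]" z] unfolding bilinear_def by (auto intro: linear_compose_neg)
  obtain f :: "'k \<Rightarrow> real^'k" where f: "\<And>i j. ?b (f i) (f j) = (if i = j then 1 else 0)"
    "\<And>v. v = (\<Sum>i\<in>UNIV. ?b (f i) v *\<^sub>R f i)"
    using orthonormal_family[OF bilinear_x b bp] by blast
  obtain h :: "'l \<Rightarrow> real^'l" where h: "\<And>i j. ?c (h i) (h j) = (if i = j then 1 else 0)"
    "\<And>v. v = (\<Sum>i\<in>UNIV. ?c (h i) v *\<^sub>R h i)"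
    using orthonormal_family[OF c_bil c cp] by blast
  define E where "E = case_sum (\<lambda>i. (f i, 0)) (\<lambda>j. (0, h j))"
  have zero: "D [(0, 0), w] z = 0" "D [w, (0, 0)] z = 0" for w
    using linear_0[OF D_linear[of "[w]" z]] linear_0[OF D_linear2[of w "[]" z]] by (simp_all add: zero_prod_def)
  have "frame z E"
    unfolding frame_def
  proof (intro conjI allI)
    fix a b
    show "metric z (E a) (E b) = (if a = b then 1 else 0)"
      using f(1) h(1) by (cases a; cases b) (simp_all add: E_def metric_def proj_x_def proj_y_def zero)
  next
    fix v :: "(real^'k) \<times> (real^'l)"
    have "fst v = fst (\<Sum>a\<in>UNIV. metric z (E a) v *\<^sub>R E a)"
      using f(2)[of "fst v"]
      by (simp add: UNIV_Plus_UNIV[symmetric] sum.Plus fst_sum E_def metric_def proj_x_def proj_y_def zero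
          del: UNIV_Plus_UNIV)
    moreover have "snd v = snd (\<Sum>a\<in>UNIV. metric z (E a) v *\<^sub>R E a)"
      using h(2)[of "snd v"]
      by (simp add: UNIV_Plus_UNIV[symmetric] sum.Plus snd_sum E_def metric_def proj_x_def proj_y_def zero
          del: UNIV_Plus_UNIV)
    ultimately show "v = (\<Sum>a\<in>UNIV. metric z (E a) v *\<^sub>R E a)" by (rule prod_eqI)
  qed (simp_all add: E_def)
  then show ?thesis by (rule that)
qed

text \<open>The second and third derivatives of the equation along the line through \<open>z\<close> in the direction
  \<open>v\<close>. In a frame both blocks are the identity at \<open>z\<close>, so the left-hand sides are the Laplacian of
  \<open>g\<close> applied to the second and third derivative of \<open>u\<close> in the direction \<open>v\<close>. Passing from the
  coordinate axes to the frame multiplies the determinants by constants and changes the equation by an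
  additive constant only.\<close>

lemma frame_equation_derivatives:
  assumes "frame z E"
  shows "(\<Sum>a\<in>UNIV. D [v, v, E a, E a] z)
      = (\<Sum>a\<in>UNIV. \<Sum>b\<in>UNIV. (block_sign a + block_sign b) / 2 * (D [v, E a, E b] z)^2)" (is ?second)
    and "(\<Sum>a\<in>UNIV. D [v, v, v, E a, E a] z)
      = 3 * (\<Sum>a\<in>UNIV. \<Sum>b\<in>UNIV. (block_sign a + block_sign b) / 2 *
          (D [v, E a, E b] z * D [v, v, E a, E b] z))
      - 1 / 2 * (\<Sum>a\<in>UNIV. \<Sum>b\<in>UNIV. \<Sum>c\<in>UNIV.
          (1 + block_sign a * block_sign b + block_sign b * block_sign c + block_sign a * block_sign c) *
          (D [v, E a, E b] z * D [v, E b, E c] z * D [v, E c, E a] z))" (is ?third)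
proof -
  define f where "f i = fst (E (Inl i))" for i
  define h where "h j = snd (E (Inr j))" for j
  have E: "E (Inl i) = (f i, 0)" "E (Inr j) = (0, h j)" for i j
    using assms by (simp_all add: frame_def f_def h_def prod_eq_iff)
  have orth: "metric z (E a) (E b) = (if a = b then 1 else 0)" for a b
    using assms by (simp add: frame_def)
  have zero: "D [(0, 0), w] z = 0" "D [w, (0, 0)] z = 0" for w
    using linear_0[OF D_linear[of "[w]" z]] linear_0[OF D_linear2[of w "[]" z]] by (simp_all add: zero_prod_def)
  have fo: "D [(f i, 0), (f j, 0)] z = (if i = j then 1 else 0)" for i j
    using orth[of "Inl i" "Inl j"] by (simp add: E metric_def proj_x_def proj_y_def zero)
  have ho: "- D [(0, h i), (0, h j)] z = (if i = j then 1 else 0)" for i j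
    using orth[of "Inr i" "Inr j"] by (simp add: E metric_def proj_x_def proj_y_def zero)
  define A where "A vs t = (\<chi> i j. D (vs @ [(f i, 0), (f j, 0)]) (z + t *\<^sub>R v))" for vs t
  define C where "C vs t = (\<chi> i j. - D (vs @ [(0, h i), (0, h j)]) (z + t *\<^sub>R v))" for vs t
  have dA: "(A vs has_vector_derivative A (v # vs) t) (at t)" for vs t
    by (rule matrix_has_vector_derivativeI) (simp add: A_def D_line)
  have dC: "(C vs has_vector_derivative C (v # vs) t) (at t)" for vs t
    by (rule matrix_has_vector_derivativeI) (simp add: C_def D_line DERIV_minus)
  have A0: "A [] 0 = mat 1" by (simp add: A_def vec_eq_iff mat_def fo)
  have C0: "C [] 0 = mat 1" using ho by (simp add: C_def vec_eq_iff mat_def)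
  \<comment> \<open>The quadratic form of \<open>A [] t\<close> is at least \<open>lam |x|\<^sup>2\<close>, where \<open>x\<close> has frame coordinates \<open>w\<close>;
    at \<open>t = 0\<close> it is \<open>|w|\<^sup>2\<close> and at most \<open>Lam |x|\<^sup>2\<close>.\<close>
  define c where "c = lam / Lam"
  have c: "c > 0" using lam Lam by (simp add: c_def)
  have Aform: "w \<bullet> (A [] t *v w) = D [(\<Sum>i\<in>UNIV. w $ i *\<^sub>R f i, 0), (\<Sum>i\<in>UNIV. w $ i *\<^sub>R f i, 0)] (z + t *\<^sub>R v)" for w t
    using inner_matrix_eq_bilinear[OF bilinear_x[of "[]" "z + t *\<^sub>R v"], of w f w] by (simp add: A_def)
  have Cform: "w \<bullet> (C [] t *v w) = - D [(0, \<Sum>i\<in>UNIV. w $ i *\<^sub>R h i), (0, \<Sum>i\<in>UNIV. w $ i *\<^sub>R h i)] (z + t *\<^sub>R v)" for w t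
  proof -
    have "bilinear (\<lambda>v w. - D [(0, v), (0, w)] y)" for y
      using bilinear_y[of "[]" y] unfolding bilinear_def by (auto intro: linear_compose_neg)
    from inner_matrix_eq_bilinear[OF this[of "z + t *\<^sub>R v"], of w h w] show ?thesis by (simp add: C_def)
  qed
  have pdA: "c * (w \<bullet> w) \<le> w \<bullet> (A [] t *v w)" for t w
  proof -
    let ?x = "\<Sum>i\<in>UNIV. w $ i *\<^sub>R f i"
    have "w \<bullet> w \<le> Lam * (?x \<bullet> ?x)"
      using Aform[of w 0] D_x_bounds(2)[of ?x z] by (simp add: A0)
    then have "c * (w \<bullet> w) \<le> lam * (?x \<bullet> ?x)"
      using lam Lam by (simp add: c_def field_simps)
    then show ?thesis using D_x_bounds(1)[of ?x "z + t *\<^sub>R v"] by (simp add: Aform)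
  qed
  have pdC: "c * (w \<bullet> w) \<le> w \<bullet> (C [] t *v w)" for t w
  proof -
    let ?x = "\<Sum>i\<in>UNIV. w $ i *\<^sub>R h i"
    have "w \<bullet> w \<le> Lam * (?x \<bullet> ?x)"
      using Cform[of w 0] D_y_bounds(2)[of ?x z] by (simp add: C0)
    then have "c * (w \<bullet> w) \<le> lam * (?x \<bullet> ?x)"
      using lam Lam by (simp add: c_def field_simps)
    then show ?thesis using D_y_bounds(1)[of ?x "z + t *\<^sub>R v"] by (simp add: Cform)
  qed
  define P where "P = (\<chi> i. f i)"
  define Q where "Q = (\<chi> i. h i)"
  have Adet: "det (A [] t) = (det P)^2 * det (hess_x u (z + t *\<^sub>R v))" for t
  proof -
    have "A [] t = P ** hess_x u (z + t *\<^sub>R v) ** transpose P"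
      by (simp add: vec_eq_iff A_def congruence_entry P_def inner_hess_x)
    then show ?thesis by (simp add: det_mul power2_eq_square)
  qed
  have Cdet: "det (C [] t) = (det Q)^2 * det (- hess_y u (z + t *\<^sub>R v))" for t
  proof -
    have neg: "- hess_y u y *v w = - (hess_y u y *v w)" for y w
      by (metis diff_0 matrix_vector_mult_0 matrix_vector_mult_diff_rdistrib)
    have "C [] t = Q ** (- hess_y u (z + t *\<^sub>R v)) ** transpose Q"
      unfolding vec_eq_iff by (simp add: C_def congruence_entry Q_def inner_hess_y neg)
    then show ?thesis by (simp add: det_mul power2_eq_square)
  qed
  have Anz: "det (A [] t) \<noteq> 0" for t
    using matrix_bounded_inverse[OF c, of "A []"] pdA det_mul det_I by (metis mult_zero_left zero_neq_one)
  have Cnz: "det (C [] t) \<noteq> 0" for t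
    using matrix_bounded_inverse[OF c, of "C []"] pdC det_mul det_I by (metis mult_zero_left zero_neq_one)
  have eq: "ln (det (A [] t)) - ln (det (C [] t)) = ln ((det P)^2) - ln ((det Q)^2)" for t
    using Anz[of t] Cnz[of t] equation[of "z + t *\<^sub>R v"] unfolding Adet Cdet by (simp add: ln_mult)
  note eqs = ln_det_equation_derivatives[OF c pdA pdC dA dA dA A0 dC dC dC C0 eq]
  define M where "M a b = D [v, E a, E b] z" for a b
  define N where "N a b = D [v, v, E a, E b] z" for a b
  define L where "L a b = D [v, v, v, E a, E b] z" for a b
  have M: "M a b = M b a" for a b unfolding M_def by (rule D_perm) simp
  have A: "A [v] 0 = (\<chi> i j. M (Inl i) (Inl j))" "A [v, v] 0 = (\<chi> i j. N (Inl i) (Inl j))"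
    "A [v, v, v] 0 = (\<chi> i j. L (Inl i) (Inl j))"
    by (simp_all add: A_def M_def N_def L_def E)
  have C: "C [v] 0 = (\<chi> i j. - M (Inr i) (Inr j))" "C [v, v] 0 = (\<chi> i j. - N (Inr i) (Inr j))"
    "C [v, v, v] 0 = (\<chi> i j. - L (Inr i) (Inr j))"
    by (simp_all add: C_def M_def N_def L_def E)
  have tr2: "trace (A [v] 0 ** A [v] 0) = (\<Sum>i\<in>UNIV. \<Sum>j\<in>UNIV. (M (Inl i) (Inl j))^2)"
    "trace (C [v] 0 ** C [v] 0) = (\<Sum>i\<in>UNIV. \<Sum>j\<in>UNIV. (M (Inr i) (Inr j))^2)"
    unfolding A C trace_def matrix_matrix_mult_def power2_eq_square
    by (auto intro!: sum.cong M)
  have trMN: "trace (A [v] 0 ** A [v, v] 0) = (\<Sum>i\<in>UNIV. \<Sum>j\<in>UNIV. M (Inl i) (Inl j) * N (Inl i) (Inl j))"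
    "trace (C [v] 0 ** C [v, v] 0) = (\<Sum>i\<in>UNIV. \<Sum>j\<in>UNIV. M (Inr i) (Inr j) * N (Inr i) (Inr j))"
  proof -
    have N: "N a b = N b a" for a b unfolding N_def by (rule D_perm) simp
    show "trace (A [v] 0 ** A [v, v] 0) = (\<Sum>i\<in>UNIV. \<Sum>j\<in>UNIV. M (Inl i) (Inl j) * N (Inl i) (Inl j))"
      "trace (C [v] 0 ** C [v, v] 0) = (\<Sum>i\<in>UNIV. \<Sum>j\<in>UNIV. M (Inr i) (Inr j) * N (Inr i) (Inr j))"
      unfolding A C trace_def matrix_matrix_mult_def by (auto intro!: sum.cong N)
  qed
  have tr3: "trace (A [v] 0 ** A [v] 0 ** A [v] 0)
      = (\<Sum>i\<in>UNIV. \<Sum>j\<in>UNIV. \<Sum>m\<in>UNIV. M (Inl i) (Inl j) * M (Inl j) (Inl m) * M (Inl m) (Inl i))"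
    "trace (C [v] 0 ** C [v] 0 ** C [v] 0)
      = - (\<Sum>i\<in>UNIV. \<Sum>j\<in>UNIV. \<Sum>m\<in>UNIV. M (Inr i) (Inr j) * M (Inr j) (Inr m) * M (Inr m) (Inr i))"
    unfolding A C trace_cube by (simp_all add: sum_negf)
  have tr1: "trace (A [v, v] 0) = (\<Sum>i\<in>UNIV. N (Inl i) (Inl i))" "trace (C [v, v] 0) = - (\<Sum>i\<in>UNIV. N (Inr i) (Inr i))"
    "trace (A [v, v, v] 0) = (\<Sum>i\<in>UNIV. L (Inl i) (Inl i))" "trace (C [v, v, v] 0) = - (\<Sum>i\<in>UNIV. L (Inr i) (Inr i))"
    unfolding A C trace_def by (simp_all add: sum_negf)
  show ?second
    unfolding M_def[symmetric] N_def[symmetric] sum_UNIV_Plus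
    using eqs(1)[unfolded tr1 tr2] by (simp add: sum_negf)
  define cx where "cx = (\<Sum>i\<in>UNIV. \<Sum>j\<in>UNIV. \<Sum>m\<in>UNIV. M (Inl i) (Inl j) * M (Inl j) (Inl m) * M (Inl m) (Inl i))"
  define cy where "cy = (\<Sum>i\<in>UNIV. \<Sum>j\<in>UNIV. \<Sum>m\<in>UNIV. M (Inr i) (Inr j) * M (Inr j) (Inr m) * M (Inr m) (Inr i))"
  define sx where "sx = (\<Sum>i\<in>UNIV. \<Sum>j\<in>UNIV. M (Inl i) (Inl j) * N (Inl i) (Inl j))"
  define sy where "sy = (\<Sum>i\<in>UNIV. \<Sum>j\<in>UNIV. M (Inr i) (Inr j) * N (Inr i) (Inr j))"
  have "(\<Sum>a\<in>UNIV. \<Sum>b\<in>UNIV. \<Sum>c\<in>UNIV.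
          (1 + block_sign a * block_sign b + block_sign b * block_sign c + block_sign a * block_sign c) *
          (M a b * M b c * M c a)) = 4 * cx + 4 * cy"
    unfolding sum_UNIV_Plus cx_def cy_def by (simp add: sum_distrib_left)
  moreover have "(\<Sum>a\<in>UNIV. \<Sum>b\<in>UNIV. (block_sign a + block_sign b) / 2 * (M a b * N a b)) = sx - sy"
    unfolding sum_UNIV_Plus sx_def sy_def by (simp add: sum_negf)
  moreover have "(\<Sum>a\<in>UNIV. L a a) = 3 * sx - 2 * cx - 3 * sy - 2 * cy"
    unfolding sum_UNIV_Plus
    using eqs(2)[unfolded tr1 trMN tr3, folded cx_def cy_def sx_def sy_def] by linarith
  ultimately show ?third
    unfolding M_def[symmetric] N_def[symmetric] L_def[symmetric] by (simp add: field_simps)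
qed

end

section \<open>The inequality at a maximum point\<close>

lemma second_derivative_test_min:
  fixes f f1 :: "real \<Rightarrow> real"
  assumes f: "\<And>t. (f has_real_derivative f1 t) (at t)" and f1: "(f1 has_real_derivative f2) (at 0)"
    and d: "d > 0" and min: "\<And>t. \<bar>t\<bar> < d \<Longrightarrow> f 0 \<le> f t"
  shows "f1 0 = 0" "f2 \<ge> 0"
proof -
  show z: "f1 0 = 0" using DERIV_local_min[OF f d] min by auto
  show "f2 \<ge> 0"
  proof (rule ccontr)
    assume "\<not> f2 \<ge> 0"
    then obtain h where h: "h > 0" "\<And>s. 0 < s \<Longrightarrow> s < h \<Longrightarrow> f1 s < 0"
      using DERIV_neg_dec_right[OF f1] z by auto
    define s where "s = min h d / 2"
    have s: "0 < s" "s < h" "s < d" using h d by (auto simp: s_def min_def)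
    obtain r where r: "0 < r" "r < s" "f s - f 0 = (s - 0) * f1 r"
      using MVT2[OF s(1), of f f1] f by blast
    moreover have "s * f1 r < 0" using h(2)[of r] r s by (intro mult_pos_neg) auto
    ultimately have "f s < f 0" by simp
    then show False using min[of s] s by simp
  qed
qed

lemma linear_sum_scaleR:
  "linear f \<Longrightarrow> f (\<Sum>a\<in>A. x a *\<^sub>R E a) = (\<Sum>a\<in>A. x a * f (E a))"
  for f :: "'a::real_vector \<Rightarrow> real"
  by (simp add: linear_sum linear_cmul)

context saddle_solution
begin

definition metric_deriv ::
  "((real^'k) \<times> (real^'l)) list \<Rightarrow> (real^'k) \<times> (real^'l) \<Rightarrow> (real^'k) \<times> (real^'l) \<Rightarrow> (real^'k) \<times> (real^'l) \<Rightarrow> real"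
  where "metric_deriv as z v w = D (as @ [proj_x v, proj_x w]) z - D (as @ [proj_y v, proj_y w]) z"

lemma metric_eq_metric_deriv: "metric z v w = metric_deriv [] z v w"
  by (simp add: metric_def metric_deriv_def)

lemma metric_deriv_line:
  "((\<lambda>t. metric_deriv as (z + t *\<^sub>R a) v w) has_real_derivative metric_deriv (a # as) (z + t *\<^sub>R a) v w) (at t)"
  unfolding metric_deriv_def append_Cons by (intro DERIV_diff D_line)

lemma D_cube_affine:
  "D [e + t *\<^sub>R w, e + t *\<^sub>R w, e + t *\<^sub>R w] y
    = D [e, e, e] y + 3 * t * D [w, e, e] y + 3 * t^2 * D [w, w, e] y + t^3 * D [w, w, w] y"
proof -
  have 1: "D ((v + t *\<^sub>R w) # vs) y = D (v # vs) y + t * D (w # vs) y" for v vs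
    by (simp add: linear_add[OF D_linear] linear_cmul[OF D_linear])
  have 2: "D (b # (v + t *\<^sub>R w) # vs) y = D (b # v # vs) y + t * D (b # w # vs) y" for b v vs
    by (simp add: linear_add[OF D_linear2] linear_cmul[OF D_linear2])
  have 3: "D (b # c # (v + t *\<^sub>R w) # vs) y = D (b # c # v # vs) y + t * D (b # c # w # vs) y" for b c v vs
    by (simp add: linear_add[OF D_linear3] linear_cmul[OF D_linear3])
  have p: "D [e, w, e] y = D [w, e, e] y" "D [e, e, w] y = D [w, e, e] y"
    "D [e, w, w] y = D [w, w, e] y" "D [w, e, w] y = D [w, w, e] y"
    by (rule D_perm; simp)+
  show ?thesis
    by (simp add: 1 2 3 p algebra_simps power2_eq_square power3_eq_cube)
qed

lemma metric_affine:
  "metric y (e + t *\<^sub>R w) (e + t *\<^sub>R w) = metric y e e + 2 * t * metric y e w + t^2 * metric y w w"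
  by (simp add: bilinear_ladd[OF bilinear_metric] bilinear_radd[OF bilinear_metric]
      bilinear_lmul[OF bilinear_metric] bilinear_rmul[OF bilinear_metric] metric_commute[of y w e]
      algebra_simps power2_eq_square)

text \<open>The second derivative test along the line through \<open>z\<close> in the direction \<open>a\<close>, with the vector
  \<open>e + t w\<close> at the point \<open>z + t a\<close>. The assumption on \<open>w\<close> says that the \<open>g\<close>-length of this vector is
  stationary at \<open>t = 0\<close>, as for a parallel vector field. Homogeneity would give the exponent \<open>3/2\<close> of
  the metric in the bound; the polynomial \<open>(r + r\<^sup>2) / 2\<close> dominates \<open>r\<^sup>3\<^sup>/\<^sup>2\<close> and agrees with it to first
  order at \<open>r = 1\<close>, which suffices where \<open>r\<close> is stationary.\<close>

lemma line_inequality: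
  assumes z: "norm z < R"
    and max: "\<And>y v. norm y < R \<Longrightarrow>
      (R^2 - y \<bullet> y) * D [v, v, v] y \<le> N * ((metric y v v + (metric y v v)^2) / 2)"
    and e: "metric z e e = 1" and \<mu>: "D [e, e, e] z = \<mu>" and N: "N = (R^2 - z \<bullet> z) * \<mu>"
    and stationary: "metric_deriv [a] z e e + 2 * metric z e w = 0"
  shows "(R^2 - z \<bullet> z) * (D [a, a, e, e, e] z + 6 * D [a, w, e, e] z + 6 * D [w, w, e] z)
    \<le> 3 / 2 * N * (metric_deriv [a, a] z e e + 4 * metric_deriv [a] z e w + 2 * metric z w w)
      + (2 * (a \<bullet> a) + 8 * (z \<bullet> a)^2 / (R^2 - z \<bullet> z)) * \<mu>"
proof -
  define \<rho> where "\<rho> = R^2 - z \<bullet> z"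
  have \<rho>: "\<rho> > 0"
    using z abs_square_less_1 norm_ge_zero[of z] by (simp add: \<rho>_def power2_norm_eq_inner[symmetric] power_strict_mono)
  define p where "p t = z + t *\<^sub>R a" for t
  define r where "r t = R^2 - (z \<bullet> z + 2 * t * (z \<bullet> a) + t^2 * (a \<bullet> a))" for t
  define r1 where "r1 t = - (2 * (z \<bullet> a) + 2 * t * (a \<bullet> a))" for t
  define \<phi> where "\<phi> t = D [e, e, e] (p t) + 3 * t * D [w, e, e] (p t) + 3 * t^2 * D [w, w, e] (p t)
    + t^3 * D [w, w, w] (p t)" for t
  define \<phi>1 where "\<phi>1 t = D [a, e, e, e] (p t) + 3 * (D [w, e, e] (p t) + t * D [a, w, e, e] (p t))
    + 3 * (2 * t * D [w, w, e] (p t) + t^2 * D [a, w, w, e] (p t))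
    + (3 * t^2 * D [w, w, w] (p t) + t^3 * D [a, w, w, w] (p t))" for t
  define \<phi>2 where "\<phi>2 = D [a, a, e, e, e] z + 6 * D [a, w, e, e] z + 6 * D [w, w, e] z"
  define \<gamma> where "\<gamma> t = metric_deriv [] (p t) e e + 2 * t * metric_deriv [] (p t) e w + t^2 * metric_deriv [] (p t) w w" for t
  define \<gamma>1 where "\<gamma>1 t = metric_deriv [a] (p t) e e
    + 2 * (metric_deriv [] (p t) e w + t * metric_deriv [a] (p t) e w)
    + (2 * t * metric_deriv [] (p t) w w + t^2 * metric_deriv [a] (p t) w w)" for t
  define \<gamma>2 where "\<gamma>2 = metric_deriv [a, a] z e e + 4 * metric_deriv [a] z e w + 2 * metric z w w"
  have D_line': "((\<lambda>t. D vs (p t)) has_real_derivative D (a # vs) (p t)) (at t)" for vs t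
    unfolding p_def by (rule D_line)
  have m_line: "((\<lambda>t. metric_deriv as (p t) v w) has_real_derivative metric_deriv (a # as) (p t) v w) (at t)"
    for as v w t
    unfolding p_def by (rule metric_deriv_line)
  have p0: "p 0 = z" by (simp add: p_def)
  have r: "(r has_real_derivative r1 t) (at t)" for t
    unfolding r_def[abs_def] r1_def by (auto intro!: derivative_eq_intros)
  have r1: "(r1 has_real_derivative - (2 * (a \<bullet> a))) (at t)" for t
    unfolding r1_def[abs_def] by (auto intro!: derivative_eq_intros)
  have \<phi>: "(\<phi> has_real_derivative \<phi>1 t) (at t)" for t
    unfolding \<phi>_def[abs_def] \<phi>1_def
    by (auto intro!: derivative_eq_intros D_line' simp: algebra_simps)
  have \<phi>1: "(\<phi>1 has_real_derivative \<phi>2) (at 0)"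
    unfolding \<phi>1_def[abs_def] \<phi>2_def
    by (auto intro!: derivative_eq_intros D_line' simp: p0)
  have \<gamma>: "(\<gamma> has_real_derivative \<gamma>1 t) (at t)" for t
    unfolding \<gamma>_def[abs_def] \<gamma>1_def
    by (auto intro!: derivative_eq_intros m_line simp: algebra_simps)
  have \<gamma>1: "(\<gamma>1 has_real_derivative \<gamma>2) (at 0)"
    unfolding \<gamma>1_def[abs_def] \<gamma>2_def metric_eq_metric_deriv
    by (auto intro!: derivative_eq_intros m_line simp: p0)
  define \<psi> where "\<psi> t = N * ((\<gamma> t + (\<gamma> t)^2) / 2) - r t * \<phi> t" for t
  define \<psi>1 where "\<psi>1 t = N * ((\<gamma>1 t + 2 * \<gamma> t * \<gamma>1 t) / 2) - (r1 t * \<phi> t + r t * \<phi>1 t)" for t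
  have at0: "\<gamma> 0 = 1" "\<gamma>1 0 = 0" "\<phi> 0 = \<mu>" "r 0 = \<rho>" "r1 0 = - 2 * (z \<bullet> a)"
    using e \<mu> stationary
    by (simp_all add: \<gamma>_def \<gamma>1_def \<phi>_def r_def r1_def p_def \<rho>_def metric_eq_metric_deriv)
  have \<psi>: "(\<psi> has_real_derivative \<psi>1 t) (at t)" for t
    unfolding \<psi>_def[abs_def] \<psi>1_def
    by (auto intro!: derivative_eq_intros \<gamma> \<phi> r simp: algebra_simps)
  have \<psi>1: "(\<psi>1 has_real_derivative
      N * (3 / 2 * \<gamma>2) - (- 2 * (a \<bullet> a) * \<mu> + 2 * (- 2 * (z \<bullet> a)) * \<phi>1 0 + \<rho> * \<phi>2)) (at 0)"
    unfolding \<psi>1_def[abs_def]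
    by (auto intro!: derivative_eq_intros \<gamma> \<phi> r r1 \<gamma>1 \<phi>1 simp: at0 algebra_simps)
  have p_cont: "isCont p 0" unfolding p_def by (intro continuous_intros)
  have "\<forall>\<^sub>F t in at 0. norm (p t) < R"
    using order_tendstoD(2)[OF tendsto_norm[OF p_cont[unfolded isCont_def]], of R] z by (simp add: p_def)
  then obtain d where d: "d > 0" "\<And>t. t \<noteq> 0 \<Longrightarrow> dist t 0 < d \<Longrightarrow> norm (p t) < R"
    unfolding eventually_at by blast
  have in_ball: "norm (p t) < R" if "\<bar>t\<bar> < d" for t
    using d(2)[of t] that z by (cases "t = 0") (auto simp: p_def)
  have min: "\<psi> 0 \<le> \<psi> t" if "\<bar>t\<bar> < d" for t
  proof -
    have "r t = R^2 - p t \<bullet> p t"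
      by (simp add: r_def p_def inner_simps inner_commute power2_eq_square algebra_simps)
    moreover have "\<phi> t = D [e + t *\<^sub>R w, e + t *\<^sub>R w, e + t *\<^sub>R w] (p t)"
      by (simp add: \<phi>_def D_cube_affine)
    moreover have "\<gamma> t = metric (p t) (e + t *\<^sub>R w) (e + t *\<^sub>R w)"
      unfolding \<gamma>_def metric_eq_metric_deriv[symmetric] by (simp add: metric_affine)
    ultimately have "0 \<le> \<psi> t"
      using max[OF in_ball[OF that]] by (simp add: \<psi>_def)
    moreover have "\<psi> 0 = 0" by (simp add: \<psi>_def at0 N \<rho>_def)
    ultimately show ?thesis by simp
  qed
  from second_derivative_test_min[OF \<psi> \<psi>1 d(1) min]
  have first: "\<rho> * \<phi>1 0 = 2 * (z \<bullet> a) * \<mu>"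
    and second: "0 \<le> N * (3 / 2 * \<gamma>2) - (- 2 * (a \<bullet> a) * \<mu> + 2 * (- 2 * (z \<bullet> a)) * \<phi>1 0 + \<rho> * \<phi>2)"
    by (simp_all add: \<psi>1_def at0)
  have "\<phi>1 0 = 2 * (z \<bullet> a) * \<mu> / \<rho>" using first \<rho> by (simp add: field_simps)
  then have "4 * (z \<bullet> a) * \<phi>1 0 = 8 * (z \<bullet> a)^2 / \<rho> * \<mu>"
    by (simp add: power2_eq_square)
  then show ?thesis
    using second unfolding \<rho>_def[symmetric] \<phi>2_def[symmetric] \<gamma>2_def[symmetric]
    by (simp add: algebra_simps)
qed

lemma frame_metric_sums:
  assumes "frame z E"
  shows "metric z (\<Sum>a\<in>UNIV. x a *\<^sub>R E a) (\<Sum>a\<in>UNIV. y a *\<^sub>R E a) = (\<Sum>a\<in>UNIV. x a * y a)"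
proof -
  have l: "linear (\<lambda>v. metric z v w)" "linear (metric z w)" for w
    using bilinear_metric[of z] unfolding bilinear_def by blast+
  have o: "metric z (E a) (E b) = (if a = b then 1 else 0)" for a b
    using assms by (simp add: frame_def)
  show ?thesis
    by (simp add: linear_sum_scaleR[OF l(1)] linear_sum_scaleR[OF l(2)] o if_distrib[of "\<lambda>r. _ * r"]
        mult.commute cong: if_cong)
qed

text \<open>A cubic form that is maximal on unit vectors at \<open>e\<close> has its Hessian at \<open>e\<close> bounded. Adding
  the maximum property at \<open>e + s v\<close> and \<open>e - s v\<close> for a unit vector \<open>s v\<close> leaves the constant
  \<open>4/3\<close>; the application needs one below \<open>3/2\<close>.\<close>

lemma cubic_bound:
  assumes max: "\<And>v. D [v, v, v] z \<le> \<mu> * ((metric z v v + (metric z v v)^2) / 2)"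
    and e: "metric z e e = 1" and \<mu>: "D [e, e, e] z = \<mu>" "\<mu> > 0"
  shows "D [v, v, e] z \<le> 4 / 3 * \<mu> * metric z v v"
proof (cases "v = 0")
  case True
  then show ?thesis
    using linear_0[OF D_linear[of "[0, e]" z]] bilinear_lzero[OF bilinear_metric[of z], of 0] by simp
next
  case False
  have "lam * (v \<bullet> v) > 0" using False lam by simp
  then have vpos: "metric z v v > 0" using metric_lower[of v z] by linarith
  define s where "s = 1 / sqrt (metric z v v)"
  have s2: "s^2 * metric z v v = 1" using vpos by (simp add: s_def power_divide)
  define q where "q = s * metric z e v"
  have g: "metric z (e + s *\<^sub>R v) (e + s *\<^sub>R v) = 2 + 2 * q"
    "metric z (e + (- s) *\<^sub>R v) (e + (- s) *\<^sub>R v) = 2 - 2 * q"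
    unfolding metric_affine using s2 e by (simp_all add: q_def)
  have nonneg: "metric z x x \<ge> 0" for x
    using metric_lower[of x z] lam by (meson inner_ge_zero less_imp_le mult_nonneg_nonneg order_trans)
  have q: "-1 \<le> q" "q \<le> 1" using nonneg g by (smt (verit))+
  then have q2: "q^2 \<le> 1" by (simp add: abs_square_le_1 abs_le_iff)
  have "2 * \<mu> + 6 * (s^2 * D [v, v, e] z)
      = D [e + s *\<^sub>R v, e + s *\<^sub>R v, e + s *\<^sub>R v] z + D [e + (- s) *\<^sub>R v, e + (- s) *\<^sub>R v, e + (- s) *\<^sub>R v] z"
    unfolding D_cube_affine by (simp add: \<mu>)
  also have "\<dots> \<le> \<mu> * ((2 + 2 * q + (2 + 2 * q)^2) / 2) + \<mu> * ((2 - 2 * q + (2 - 2 * q)^2) / 2)"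
    using max[of "e + s *\<^sub>R v"] max[of "e + (- s) *\<^sub>R v"] unfolding g by simp
  also have "\<dots> = \<mu> * (6 + 4 * q^2)" by (simp add: power2_eq_square field_simps)
  also have "\<dots> \<le> \<mu> * 10" using q2 \<mu>(2) by (intro mult_left_mono) auto
  finally have "s^2 * D [v, v, e] z \<le> 4 / 3 * \<mu>" by simp
  then have "s^2 * D [v, v, e] z * metric z v v \<le> 4 / 3 * \<mu> * metric z v v"
    using vpos by (intro mult_right_mono) auto
  moreover have "s^2 * D [v, v, e] z * metric z v v = D [v, v, e] z"
    using arg_cong[OF s2, of "\<lambda>x. D [v, v, e] z * x"] by (simp only: mult_ac mult_1_left mult_1_right)
  ultimately show ?thesis by simp
qed

end

lemma sum_sign_symmetrize:
  fixes F :: "'a::finite \<Rightarrow> 'a \<Rightarrow> real"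
  assumes "\<And>a b. F a b = F b a"
  shows "(\<Sum>a\<in>UNIV. \<Sum>b\<in>UNIV. s b * F a b) = (\<Sum>a\<in>UNIV. \<Sum>b\<in>UNIV. (s a + s b) / 2 * F a b)"
proof -
  have "(\<Sum>a\<in>UNIV. \<Sum>b\<in>UNIV. s a * F a b) = (\<Sum>b\<in>UNIV. \<Sum>a\<in>UNIV. s a * F a b)"
    by (rule sum.swap)
  also have "\<dots> = (\<Sum>a\<in>UNIV. \<Sum>b\<in>UNIV. s b * F a b)" by (simp add: assms)
  finally have "(\<Sum>a\<in>UNIV. \<Sum>b\<in>UNIV. s a * F a b) = (\<Sum>a\<in>UNIV. \<Sum>b\<in>UNIV. s b * F a b)" .
  then show ?thesis
    by (simp add: field_simps sum.distrib sum_divide_distrib[symmetric])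
qed

text \<open>The three products of signs contribute equally, since \<open>M a b * M b c * M c a\<close> is invariant under
  permutations of \<open>a\<close>, \<open>b\<close>, \<open>c\<close>.\<close>

lemma sum_sign_cube:
  fixes M :: "'a::finite \<Rightarrow> 'a \<Rightarrow> real"
  assumes sym: "\<And>a b. M a b = M b a"
  shows "(\<Sum>a\<in>UNIV. \<Sum>b\<in>UNIV. \<Sum>c\<in>UNIV. (1 + s a * s b + s b * s c + s a * s c) * (M a b * M b c * M c a))
    = (\<Sum>a\<in>UNIV. \<Sum>b\<in>UNIV. \<Sum>c\<in>UNIV. M a b * M b c * M c a)
      + 3 * (\<Sum>a\<in>UNIV. \<Sum>b\<in>UNIV. \<Sum>c\<in>UNIV. s b * s c * (M a b * M b c * M c a))"
proof -
  let ?T = "\<lambda>a b c. M a b * M b c * M c a"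
  have T: "?T c a b = ?T a b c" "?T b a c = ?T a b c" for a b c
    using sym[of a b] sym[of b c] sym[of a c] by simp_all
  have 1: "(\<Sum>a\<in>UNIV. \<Sum>b\<in>UNIV. \<Sum>c\<in>UNIV. s a * s c * ?T a b c)
      = (\<Sum>a\<in>UNIV. \<Sum>b\<in>UNIV. \<Sum>c\<in>UNIV. s b * s c * ?T a b c)"
    by (subst sum.swap) (simp only: T(2))
  have "(\<Sum>a\<in>UNIV. \<Sum>b\<in>UNIV. \<Sum>c\<in>UNIV. s a * s b * ?T a b c)
      = (\<Sum>a\<in>UNIV. \<Sum>c\<in>UNIV. \<Sum>b\<in>UNIV. s a * s b * ?T a b c)"
    by (rule sum.cong[OF refl], rule sum.swap)
  also have "\<dots> = (\<Sum>c\<in>UNIV. \<Sum>a\<in>UNIV. \<Sum>b\<in>UNIV. s a * s b * ?T a b c)"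
    by (rule sum.swap)
  also have "\<dots> = (\<Sum>a\<in>UNIV. \<Sum>b\<in>UNIV. \<Sum>c\<in>UNIV. s b * s c * ?T a b c)"
    by (simp only: T(1)[symmetric])
  finally have 2: "(\<Sum>a\<in>UNIV. \<Sum>b\<in>UNIV. \<Sum>c\<in>UNIV. s a * s b * ?T a b c)
      = (\<Sum>a\<in>UNIV. \<Sum>b\<in>UNIV. \<Sum>c\<in>UNIV. s b * s c * ?T a b c)" .
  have "(\<Sum>a\<in>UNIV. \<Sum>b\<in>UNIV. \<Sum>c\<in>UNIV. (1 + s a * s b + s b * s c + s a * s c) * ?T a b c)
      = (\<Sum>a\<in>UNIV. \<Sum>b\<in>UNIV. \<Sum>c\<in>UNIV. ?T a b c)
      + (\<Sum>a\<in>UNIV. \<Sum>b\<in>UNIV. \<Sum>c\<in>UNIV. s a * s b * ?T a b c)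
      + (\<Sum>a\<in>UNIV. \<Sum>b\<in>UNIV. \<Sum>c\<in>UNIV. s b * s c * ?T a b c)
      + (\<Sum>a\<in>UNIV. \<Sum>b\<in>UNIV. \<Sum>c\<in>UNIV. s a * s c * ?T a b c)"
    by (simp only: distrib_right mult_1_left sum.distrib)
  then show ?thesis unfolding 1 2 by simp
qed

context saddle_solution
begin

text \<open>Calabi's inequality at the maximum point, the sum of \<open>line_inequality\<close> over a frame. The
  vectors \<open>w a\<close> move \<open>e\<close> parallel for \<open>g\<close> to first order in the direction \<open>E a\<close>: they are minus the
  Christoffel symbols applied to \<open>e\<close>. With this choice the fourth derivatives of \<open>u\<close> left over from
  the third derivative of the equation cancel against those from moving \<open>e\<close>, and the block
  signs disappear from all cubic and quadratic expressions in \<open>M\<close>: the Laplacian of the cubic form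
  along \<open>e\<close> becomes \<open>- tr M\<^sup>3 / 2\<close>, and that of the squared length becomes \<open>- tr M\<^sup>2 / 2\<close>.\<close>

lemma frame_inequality:
  assumes E: "frame z E" and z: "norm z < R"
    and max: "\<And>y v. norm y < R \<Longrightarrow>
      (R^2 - y \<bullet> y) * D [v, v, v] y \<le> (R^2 - z \<bullet> z) * \<mu> * ((metric y v v + (metric y v v)^2) / 2)"
    and e: "metric z e e = 1" and \<mu>: "D [e, e, e] z = \<mu>" "\<mu> > 0"
  shows "(R^2 - z \<bullet> z) * \<mu>^2 / 12
    \<le> (\<Sum>a\<in>UNIV. 2 * (E a \<bullet> E a) + 8 * (z \<bullet> E a)^2 / (R^2 - z \<bullet> z))"
proof -
  define \<rho> where "\<rho> = R^2 - z \<bullet> z"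
  have \<rho>: "\<rho> > 0"
    using z norm_ge_zero[of z] by (simp add: \<rho>_def power2_norm_eq_inner[symmetric] power_strict_mono)
  let ?s = "block_sign :: 'k + 'l \<Rightarrow> real"
  define \<xi> where "\<xi> a = metric z (E a) e" for a
  have e_exp: "e = (\<Sum>a\<in>UNIV. \<xi> a *\<^sub>R E a)"
    using E unfolding frame_def \<xi>_def by blast
  have \<xi>2: "(\<Sum>a\<in>UNIV. \<xi> a * \<xi> a) = 1"
    using frame_metric_sums[OF E, of \<xi> \<xi>] e e_exp by simp
  have ss: "?s c * ?s c = 1" for c by (cases c) simp_all
  have proj: "proj_x (E c) = ((1 + ?s c) / 2) *\<^sub>R E c" "proj_y (E c) = ((1 - ?s c) / 2) *\<^sub>R E c" for c
    using E by (cases c; simp add: frame_def proj_x_def proj_y_def prod_eq_iff)+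
  have proj_sum: "proj_x (\<Sum>c\<in>UNIV. x c *\<^sub>R E c) = (\<Sum>c\<in>UNIV. (x c * ((1 + ?s c) / 2)) *\<^sub>R E c)"
    "proj_y (\<Sum>c\<in>UNIV. x c *\<^sub>R E c) = (\<Sum>c\<in>UNIV. (x c * ((1 - ?s c) / 2)) *\<^sub>R E c)" for x
    by (simp_all only: linear_sum[OF linear_proj_x] linear_cmul[OF linear_proj_x]
        linear_sum[OF linear_proj_y] linear_cmul[OF linear_proj_y] proj scaleR_scaleR)
  define M where "M a b = D [E a, E b, e] z" for a b
  define Mx where "Mx a b = D [E a, E b, proj_x e] z" for a b
  define My where "My a b = D [E a, E b, proj_y e] z" for a b
  define Q where "Q a b = D [E a, E b, e, e] z" for a b
  have split: "e = proj_x e + proj_y e" by (simp add: proj_x_def proj_y_def prod_eq_iff)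
  have M_split: "M a b = Mx a b + My a b" for a b
    unfolding M_def Mx_def My_def using linear_add[OF D_linear3, of "E a" "E b" "proj_x e" "proj_y e" "[]" z] split by simp
  have sym: "M a b = M b a" "Mx a b = Mx b a" "My a b = My b a" "Q a b = Q b a" for a b
    unfolding M_def Mx_def My_def Q_def by (rule D_perm; simp)+
  define w where "w a = (\<Sum>c\<in>UNIV. (- 1 / 2 * ?s c * M a c) *\<^sub>R E c)" for a
  have stationary: "metric_deriv [E a] z e e + 2 * metric z e (w a) = 0" for a
  proof -
    have "metric z e (w a) = (\<Sum>c\<in>UNIV. \<xi> c * (- 1 / 2 * ?s c * M a c))"
      unfolding w_def by (subst e_exp) (rule frame_metric_sums[OF E])
    also have "\<dots> = - 1 / 2 * (\<Sum>c\<in>UNIV. (\<xi> c * ?s c) * M a c)"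
      by (simp add: sum_distrib_left algebra_simps)
    also have "(\<Sum>c\<in>UNIV. (\<xi> c * ?s c) * M a c) = D [E a, (\<Sum>c\<in>UNIV. (\<xi> c * ?s c) *\<^sub>R E c), e] z"
      unfolding M_def by (rule linear_sum_scaleR[OF D_linear2, symmetric])
    also have "(\<Sum>c\<in>UNIV. (\<xi> c * ?s c) *\<^sub>R E c) = proj_x e - proj_y e"
      by (subst (1 2) e_exp) (simp add: proj_sum sum_subtractf[symmetric] scaleR_diff_left[symmetric] field_simps)
    also have "D [E a, proj_x e - proj_y e, e] z = D [E a, proj_x e - proj_y e, proj_x e + proj_y e] z"
      using split by simp
    also have "\<dots> = metric_deriv [E a] z e e"
    proof -
      have "D [E a, proj_y e, proj_x e] z = D [E a, proj_x e, proj_y e] z" by (rule D_perm) simp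
      then show ?thesis
        by (simp add: linear_diff[OF D_linear2] linear_add[OF D_linear3] metric_deriv_def)
    qed
    finally show ?thesis by simp
  qed
  \<comment> \<open>\<open>A\<close> is \<open>tr M\<^sup>2\<close> and \<open>T\<close> is \<open>tr M\<^sup>3\<close>; \<open>U\<close>, \<open>V\<close> and \<open>W\<close> are the sums with block signs, which cancel.\<close>
  define A where "A = (\<Sum>a\<in>UNIV. \<Sum>b\<in>UNIV. (M a b)^2)"
  define T where "T = (\<Sum>a\<in>UNIV. \<Sum>b\<in>UNIV. \<Sum>c\<in>UNIV. M a b * M b c * M c a)"
  define U where "U = (\<Sum>a\<in>UNIV. \<Sum>b\<in>UNIV. \<Sum>c\<in>UNIV. ?s b * ?s c * (M a b * M b c * M c a))"
  define V where "V = (\<Sum>a\<in>UNIV. \<Sum>b\<in>UNIV. (?s a + ?s b) / 2 * (M a b * Q a b))"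
  define W where "W = (\<Sum>a\<in>UNIV. \<Sum>b\<in>UNIV. (?s a + ?s b) / 2 * (M a b * (Mx a b - My a b)))"
  have phi: "(\<Sum>a\<in>UNIV. D [E a, E a, e, e, e] z + 6 * D [E a, w a, e, e] z + 6 * D [w a, w a, e] z) = - T / 2"
  proof -
    have 1: "(\<Sum>a\<in>UNIV. D [E a, E a, e, e, e] z) = 3 * V - (T + 3 * U) / 2"
    proof -
      have p: "D [E a, E a, e, e, e] z = D [e, e, e, E a, E a] z" "D [e, E a, E b] z = M a b"
        "D [e, e, E a, E b] z = Q a b" for a b
        unfolding M_def Q_def by (rule D_perm; simp)+
      show ?thesis
        using frame_equation_derivatives(2)[OF E, of e] sum_sign_cube[OF sym(1), of ?s]
        unfolding p V_def T_def U_def by simp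
    qed
    have 2: "(\<Sum>a\<in>UNIV. D [E a, w a, e, e] z) = - V / 2"
    proof -
      have "D [E a, w a, e, e] z = (\<Sum>c\<in>UNIV. (- 1 / 2 * ?s c * M a c) * Q a c)" for a
        unfolding w_def Q_def by (rule linear_sum_scaleR[OF D_linear2])
      then have "(\<Sum>a\<in>UNIV. D [E a, w a, e, e] z) = - 1 / 2 * (\<Sum>a\<in>UNIV. \<Sum>c\<in>UNIV. ?s c * (M a c * Q a c))"
        by (simp add: sum_distrib_left algebra_simps)
      also have "(\<Sum>a\<in>UNIV. \<Sum>c\<in>UNIV. ?s c * (M a c * Q a c)) = V"
        unfolding V_def by (rule sum_sign_symmetrize) (simp only: sym)
      finally show ?thesis by simp
    qed
    have 3: "(\<Sum>a\<in>UNIV. D [w a, w a, e] z) = U / 4"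
    proof -
      have "D [w a, w a, e] z = (\<Sum>b\<in>UNIV. (- 1 / 2 * ?s b * M a b) * (\<Sum>c\<in>UNIV. (- 1 / 2 * ?s c * M a c) * M b c))" for a
        unfolding w_def M_def
        by (subst linear_sum_scaleR[OF D_linear]) (simp only: linear_sum_scaleR[OF D_linear2])
      then have "(\<Sum>a\<in>UNIV. D [w a, w a, e] z)
          = (\<Sum>a\<in>UNIV. \<Sum>b\<in>UNIV. \<Sum>c\<in>UNIV. 1 / 4 * (?s b * ?s c * (M a b * M b c * M a c)))"
        by (simp add: sum_distrib_left algebra_simps)
      also have "\<dots> = U / 4"
        unfolding U_def sum_divide_distrib using sym(1) by (intro sum.cong refl) simp
      finally show ?thesis .
    qed
    show ?thesis by (simp add: sum.distrib sum_distrib_left[symmetric] 1 2 3 field_simps)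
  qed
  have gam: "(\<Sum>a\<in>UNIV. metric_deriv [E a, E a] z e e + 4 * metric_deriv [E a] z e (w a) + 2 * metric z (w a) (w a)) = - A / 2"
  proof -
    have 1: "(\<Sum>a\<in>UNIV. metric_deriv [E a, E a] z e e) = W"
    proof -
      have p: "D [E a, E a, v, v] z = D [v, v, E a, E a] z" "D [v, E a, E b] z = D [E a, E b, v] z" for a b v
        by (rule D_perm; simp)+
      have "(\<Sum>a\<in>UNIV. metric_deriv [E a, E a] z e e)
          = (\<Sum>a\<in>UNIV. \<Sum>b\<in>UNIV. (?s a + ?s b) / 2 * (Mx a b)^2) - (\<Sum>a\<in>UNIV. \<Sum>b\<in>UNIV. (?s a + ?s b) / 2 * (My a b)^2)"
        using frame_equation_derivatives(1)[OF E, of "proj_x e"] frame_equation_derivatives(1)[OF E, of "proj_y e"]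
        by (simp add: metric_deriv_def sum_subtractf p(1) p(2)[of "proj_x e"] p(2)[of "proj_y e"] Mx_def My_def)
      also have "\<dots> = W"
        unfolding W_def M_split sum_subtractf[symmetric]
        by (intro sum.cong refl) (simp add: power2_eq_square field_simps)
      finally show ?thesis .
    qed
    have 2: "(\<Sum>a\<in>UNIV. metric_deriv [E a] z e (w a)) = - 1 / 4 * (A + W)"
    proof -
      have x: "D [E a, proj_x e, proj_x (w a)] z = (\<Sum>c\<in>UNIV. - 1 / 4 * ((1 + ?s c) * (M a c * Mx a c)))" for a
      proof -
        have "D [E a, proj_x e, E c] z = Mx a c" for c unfolding Mx_def by (rule D_perm) simp
        then show ?thesis
          unfolding w_def proj_sum linear_sum_scaleR[OF D_linear3]
          by (intro sum.cong refl) (simp add: field_simps ss)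
      qed
      have y: "D [E a, proj_y e, proj_y (w a)] z = (\<Sum>c\<in>UNIV. 1 / 4 * ((1 - ?s c) * (M a c * My a c)))" for a
      proof -
        have "D [E a, proj_y e, E c] z = My a c" for c unfolding My_def by (rule D_perm) simp
        then show ?thesis
          unfolding w_def proj_sum linear_sum_scaleR[OF D_linear3]
          by (intro sum.cong refl) (simp add: field_simps ss)
      qed
      have "(\<Sum>a\<in>UNIV. metric_deriv [E a] z e (w a))
          = (\<Sum>a\<in>UNIV. \<Sum>c\<in>UNIV. - 1 / 4 * ((M a c)^2 + ?s c * (M a c * (Mx a c - My a c))))"
        unfolding metric_deriv_def append_Cons append_Nil x y sum_subtractf[symmetric]
        by (intro sum.cong refl) (simp add: M_split power2_eq_square field_simps)
      also have "\<dots> = - 1 / 4 * (A + (\<Sum>a\<in>UNIV. \<Sum>c\<in>UNIV. ?s c * (M a c * (Mx a c - My a c))))"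
        unfolding A_def sum.distrib[symmetric] sum_distrib_left ..
      also have "(\<Sum>a\<in>UNIV. \<Sum>c\<in>UNIV. ?s c * (M a c * (Mx a c - My a c))) = W"
        unfolding W_def by (rule sum_sign_symmetrize) (simp only: sym)
      finally show ?thesis .
    qed
    have 3: "(\<Sum>a\<in>UNIV. metric z (w a) (w a)) = A / 4"
    proof -
      have "metric z (w a) (w a) = (\<Sum>c\<in>UNIV. 1 / 4 * (?s c * ?s c) * (M a c)^2)" for a
        unfolding w_def frame_metric_sums[OF E] by (simp add: power2_eq_square mult_ac)
      then have "metric z (w a) (w a) = (\<Sum>c\<in>UNIV. 1 / 4 * (M a c)^2)" for a by (simp add: ss)
      then show ?thesis by (simp add: A_def sum_divide_distrib)
    qed
    show ?thesis
      unfolding sum.distrib sum_distrib_left[symmetric] 1 2 3 by (simp add: algebra_simps add_divide_distrib)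
  qed
  have cubic: "T \<le> 4 / 3 * \<mu> * A"
  proof -
    have max_z: "D [v, v, v] z \<le> \<mu> * ((metric z v v + (metric z v v)^2) / 2)" for v
      using max[OF z, of v] \<rho> by (simp add: \<rho>_def[symmetric] mult.assoc)
    \<comment> \<open>\<open>tr M\<^sup>3\<close> is the trace of the form \<open>D\<^sup>3u(e, -, -)\<close> evaluated on the rows of \<open>M\<close>.\<close>
    define m where "m a = (\<Sum>c\<in>UNIV. M a c *\<^sub>R E c)" for a
    have "D [m a, m a, e] z = (\<Sum>b\<in>UNIV. M a b * (\<Sum>c\<in>UNIV. M a c * M b c))" for a
      unfolding m_def M_def
      by (subst linear_sum_scaleR[OF D_linear]) (simp only: linear_sum_scaleR[OF D_linear2])
    then have "(\<Sum>a\<in>UNIV. D [m a, m a, e] z) = T"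
      unfolding T_def using sym(1) by (simp add: sum_distrib_left mult_ac)
    moreover have "metric z (m a) (m a) = (\<Sum>c\<in>UNIV. (M a c)^2)" for a
      unfolding m_def frame_metric_sums[OF E] by (simp add: power2_eq_square)
    moreover have "(\<Sum>a\<in>UNIV. D [m a, m a, e] z) \<le> (\<Sum>a\<in>UNIV. 4 / 3 * \<mu> * metric z (m a) (m a))"
      by (intro sum_mono cubic_bound max_z e \<mu>)
    ultimately show ?thesis by (simp add: A_def sum_distrib_left)
  qed
  have A: "\<mu>^2 \<le> A"
  proof -
    have "\<mu> = (\<Sum>a\<in>UNIV. \<xi> a * (\<Sum>b\<in>UNIV. \<xi> b * M a b))"
      unfolding M_def \<mu>(1)[symmetric]
      by (subst (1 2) e_exp, subst linear_sum_scaleR[OF D_linear]) (simp only: linear_sum_scaleR[OF D_linear2])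
    also have "\<dots> = (\<Sum>p\<in>UNIV. (\<xi> (fst p) * \<xi> (snd p)) * M (fst p) (snd p))"
      by (simp add: sum_distrib_left mult.assoc UNIV_Times_UNIV[symmetric] sum.cartesian_product case_prod_beta del: UNIV_Times_UNIV)
    finally have "\<mu>^2 \<le> (\<Sum>p\<in>UNIV. (\<xi> (fst p) * \<xi> (snd p))^2) * (\<Sum>p\<in>UNIV. (M (fst p) (snd p))^2)"
      using Cauchy_Schwarz_ineq_sum[of "\<lambda>p. \<xi> (fst p) * \<xi> (snd p)" "\<lambda>p. M (fst p) (snd p)" UNIV] by simp
    moreover have "(\<Sum>p\<in>UNIV. (\<xi> (fst p) * \<xi> (snd p))^2) = (\<Sum>a\<in>UNIV. \<xi> a * \<xi> a) * (\<Sum>a\<in>UNIV. \<xi> a * \<xi> a)"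
      by (simp add: sum_product UNIV_Times_UNIV[symmetric] sum.cartesian_product case_prod_beta power2_eq_square mult_ac del: UNIV_Times_UNIV)
    moreover have "(\<Sum>p\<in>UNIV. (M (fst p) (snd p))^2) = A"
      by (simp add: A_def UNIV_Times_UNIV[symmetric] sum.cartesian_product case_prod_beta del: UNIV_Times_UNIV)
    ultimately show ?thesis by (simp add: \<xi>2)
  qed
  define B where "B = (\<Sum>a\<in>UNIV. 2 * (E a \<bullet> E a) + 8 * (z \<bullet> E a)^2 / \<rho>)"
  have "\<rho> * (\<Sum>a\<in>UNIV. D [E a, E a, e, e, e] z + 6 * D [E a, w a, e, e] z + 6 * D [w a, w a, e] z)
    \<le> 3 / 2 * (\<rho> * \<mu>) * (\<Sum>a\<in>UNIV. metric_deriv [E a, E a] z e e + 4 * metric_deriv [E a] z e (w a) + 2 * metric z (w a) (w a))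
      + B * \<mu>"
    unfolding sum_distrib_left B_def sum_distrib_right sum.distrib[symmetric]
    using line_inequality[OF z max e \<mu>(1) refl stationary] by (intro sum_mono) (simp add: \<rho>_def)
  then have "\<rho> * (3 / 4 * \<mu> * A - T / 2) \<le> B * \<mu>"
    unfolding phi gam by (simp add: algebra_simps)
  moreover have "\<mu> * \<mu>^2 / 12 \<le> 3 / 4 * \<mu> * A - T / 2"
  proof -
    have "T \<le> 4 / 3 * (\<mu> * A)" using cubic by (simp add: mult.assoc)
    moreover have "\<mu> * \<mu>^2 \<le> \<mu> * A" using A \<mu>(2) by (intro mult_left_mono) auto
    moreover have "3 / 4 * \<mu> * A = 3 / 4 * (\<mu> * A)" by simp
    ultimately show ?thesis by linarith
  qed
  ultimately have "\<rho> * (\<mu> * \<mu>^2 / 12) \<le> B * \<mu>"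
    using mult_left_mono[of "\<mu> * \<mu>^2 / 12" "3 / 4 * \<mu> * A - T / 2" \<rho>] \<rho> by linarith
  then have "(\<rho> * \<mu>^2 / 12) * \<mu> \<le> B * \<mu>" by (simp add: mult_ac)
  then show ?thesis using \<mu>(2) by (simp add: B_def \<rho>_def)
qed

end

section \<open>The third derivatives vanish\<close>

context saddle_solution
begin

lemma continuous_on_D_slots:
  fixes p f :: "'b::topological_space \<Rightarrow> (real^'k) \<times> (real^'l)"
  assumes p: "continuous_on S p" and f: "continuous_on S f"
    and vs: "\<And>v. continuous_on S (\<lambda>q. D (v # g q) (p q))"
  shows "continuous_on S (\<lambda>q. D (f q # g q) (p q))"
proof -
  have "D (f q # g q) (p q) = (\<Sum>b\<in>Basis. (f q \<bullet> b) * D (b # g q) (p q))" for q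
    using linear_sum_scaleR[OF D_linear, of "\<lambda>b. f q \<bullet> b" "\<lambda>b. b" Basis "g q" "p q"]
    by (simp add: euclidean_representation)
  then show ?thesis using f vs by (simp add: continuous_intros)
qed

lemma D_swap_12: "D (a # b # vs) y = D (b # a # vs) y"
  by (rule D_perm) simp

lemma D_rotate_3: "D (a # b # c # vs) y = D (c # a # b # vs) y"
  by (rule D_perm) simp

lemma continuous_on_D2:
  assumes p: "continuous_on S p" and f: "continuous_on S f" "continuous_on S g"
  shows "continuous_on S (\<lambda>q. D [f q, g q] (p q))"
proof -
  have 0: "continuous_on S (\<lambda>q. D vs (p q))" for vs
    by (rule continuous_on_compose2[OF D_continuous p]) simp
  show ?thesis
  proof (rule continuous_on_D_slots[OF p f(1)])
    show "continuous_on S (\<lambda>q. D [v, g q] (p q))" for v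
      unfolding D_swap_12[of v] by (rule continuous_on_D_slots[OF p f(2) 0])
  qed
qed

lemma continuous_on_D3:
  assumes p: "continuous_on S p" and f: "continuous_on S f"
  shows "continuous_on S (\<lambda>q. D [f q, f q, f q] (p q))"
proof -
  have 0: "continuous_on S (\<lambda>q. D vs (p q))" for vs
    by (rule continuous_on_compose2[OF D_continuous p]) simp
  have 1: "continuous_on S (\<lambda>q. D [f q, v, w] (p q))" for v w
    by (rule continuous_on_D_slots[OF p f 0])
  have 2: "continuous_on S (\<lambda>q. D [f q, w, f q] (p q))" for w
  proof (rule continuous_on_D_slots[OF p f])
    show "continuous_on S (\<lambda>q. D [v, w, f q] (p q))" for v
      unfolding D_rotate_3[of v] by (rule 1)
  qed
  show ?thesis
  proof (rule continuous_on_D_slots[OF p f])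
    show "continuous_on S (\<lambda>q. D [v, f q, f q] (p q))" for v
      unfolding D_swap_12[of v] by (rule 2)
  qed
qed

lemma continuous_on_metric:
  assumes "continuous_on S p" "continuous_on S f"
  shows "continuous_on S (\<lambda>q. metric (p q) (f q) (f q))"
  unfolding metric_def proj_x_def proj_y_def
  by (intro continuous_intros continuous_on_D2 assms)

lemma metric_pos: "v \<noteq> 0 \<Longrightarrow> metric z v v > 0"
proof -
  assume "v \<noteq> 0"
  then have "lam * (v \<bullet> v) > 0" using lam by simp
  then show ?thesis using metric_lower[of v z] by linarith
qed

lemma D_cube_scale: "D [s *\<^sub>R v, s *\<^sub>R v, s *\<^sub>R v] y = s^3 * D [v, v, v] y"
  by (simp add: linear_cmul[OF D_linear] linear_cmul[OF D_linear2] linear_cmul[OF D_linear3]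
      power3_eq_cube)

lemma metric_scale: "metric y (s *\<^sub>R v) (s *\<^sub>R v) = s^2 * metric y v v"
  by (simp add: bilinear_lmul[OF bilinear_metric] bilinear_rmul[OF bilinear_metric] power2_eq_square)

lemma normalize:
  assumes "v \<noteq> 0"
  obtains s where "s > 0" "s^2 = metric y v v" "metric y ((1 / s) *\<^sub>R v) ((1 / s) *\<^sub>R v) = 1"
    "D [v, v, v] x = s^3 * D [(1 / s) *\<^sub>R v, (1 / s) *\<^sub>R v, (1 / s) *\<^sub>R v] x"
proof (rule that[of "sqrt (metric y v v)"])
  have g: "metric y v v > 0" by (rule metric_pos[OF assms])
  then show "sqrt (metric y v v) > 0" "(sqrt (metric y v v))^2 = metric y v v" by simp_all
  show "metric y ((1 / sqrt (metric y v v)) *\<^sub>R v) ((1 / sqrt (metric y v v)) *\<^sub>R v) = 1"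
    unfolding metric_scale using g by (simp add: power_divide)
  show "D [v, v, v] x = sqrt (metric y v v)^3 * D [(1 / sqrt (metric y v v)) *\<^sub>R v,
     (1 / sqrt (metric y v v)) *\<^sub>R v, (1 / sqrt (metric y v v)) *\<^sub>R v] x"
    unfolding D_cube_scale using g by (simp add: power_divide)
qed

lemma compact_unit_vectors: "compact {q. norm (fst q) \<le> R \<and> metric (fst q) (snd q) (snd q) = 1}"
proof -
  have "norm (snd q) \<le> sqrt (1 / lam)" if "metric (fst q) (snd q) (snd q) = 1" for q
    using metric_lower[of "snd q" "fst q"] that lam
    by (intro real_le_rsqrt) (simp add: power2_norm_eq_inner field_simps)
  then have "{q. norm (fst q) \<le> R \<and> metric (fst q) (snd q) (snd q) = 1} \<subseteq> cball 0 R \<times> cball 0 (sqrt (1 / lam))"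
    by auto
  then have "bounded {q. norm (fst q) \<le> R \<and> metric (fst q) (snd q) (snd q) = 1}"
    by (rule bounded_subset[OF bounded_Times[OF bounded_cball bounded_cball]])
  moreover have "closed {q. norm (fst q) \<le> R \<and> metric (fst q) (snd q) (snd q) = 1}"
    by (intro closed_Collect_conj closed_Collect_le closed_Collect_eq continuous_on_metric continuous_intros)
  ultimately show ?thesis by (simp add: compact_eq_bounded_closed)
qed

text \<open>At a maximum \<open>(z, e)\<close> of \<open>f\<close> with \<open>\<rho> = R\<^sup>2 - |z|\<^sup>2\<close>, \<open>frame_inequality\<close> bounds \<open>(\<rho> \<mu>)\<^sup>2\<close> by
  \<open>12\<close> times a sum over the frame of terms at most \<open>2 R\<^sup>2 / lam + 8 R\<^sup>2 / lam\<close>. The bound grows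
  linearly in \<open>R\<close>, whereas the factor of \<open>D\<^sup>3u\<close> grows quadratically.\<close>

lemma interior_cubic_bound:
  assumes y: "norm y < R" and v: "metric y v v = 1"
  shows "(R^2 - y \<bullet> y) * D [v, v, v] y \<le> sqrt (120 * real CARD('k + 'l) / lam) * R"
proof -
  define f where "f q = (R^2 - fst q \<bullet> fst q) * D [snd q, snd q, snd q] (fst q)" for q
  let ?S = "{q. norm (fst q) \<le> R \<and> metric (fst q) (snd q) (snd q) = 1}"
  have R: "R > 0" using y norm_ge_zero[of y] by linarith
  have yv: "(y, v) \<in> ?S" using y v by simp
  have "continuous_on ?S f"
    unfolding f_def by (intro continuous_intros continuous_on_D3)
  then obtain q where q: "q \<in> ?S" and q_max: "\<And>p. p \<in> ?S \<Longrightarrow> f p \<le> f q"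
    using continuous_attains_sup[OF compact_unit_vectors] yv by (metis (no_types, lifting) empty_iff)
  obtain z e where ze: "q = (z, e)" by (cases q)
  have z: "norm z \<le> R" and e: "metric z e e = 1" using q ze by auto
  define n where "n = real CARD('k + 'l)"
  define \<rho> where "\<rho> = R^2 - z \<bullet> z"
  define \<mu> where "\<mu> = D [e, e, e] z"
  have fq: "f q = \<rho> * \<mu>" by (simp add: f_def ze \<rho>_def \<mu>_def)
  have bound: "f q \<le> sqrt (120 * real CARD('k + 'l) / lam) * R"
  proof (cases "f q \<le> 0")
    case True
    moreover have "0 \<le> sqrt (120 * real CARD('k + 'l) / lam) * R" using R lam by simp
    ultimately show ?thesis by linarith
  next
    case False
    have "\<rho> \<ge> 0" using z by (simp add: \<rho>_def power2_norm_eq_inner[symmetric] power_mono)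
    with False have \<rho>: "\<rho> > 0" and \<mu>: "\<mu> > 0"
      unfolding fq by (auto simp: not_le zero_less_mult_iff)
    have zR: "norm z < R"
      using \<rho> R by (simp add: \<rho>_def power2_norm_eq_inner[symmetric] power_less_imp_less_base)
    have max: "(R^2 - x \<bullet> x) * D [w, w, w] x \<le> (R^2 - z \<bullet> z) * \<mu> * ((metric x w w + (metric x w w)^2) / 2)"
      if x: "norm x < R" for x w
    proof (cases "w = 0")
      case True
      then show ?thesis
        using linear_0[OF D_linear[of "[0, 0]" x]] bilinear_lzero[OF bilinear_metric[of x], of 0] by simp
    next
      case False
      obtain s where s: "s > 0" "s^2 = metric x w w" "metric x ((1 / s) *\<^sub>R w) ((1 / s) *\<^sub>R w) = 1"
        "D [w, w, w] x = s^3 * D [(1 / s) *\<^sub>R w, (1 / s) *\<^sub>R w, (1 / s) *\<^sub>R w] x"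
        using normalize[OF False] by metis
      have "f (x, (1 / s) *\<^sub>R w) \<le> \<rho> * \<mu>"
        using q_max[of "(x, (1 / s) *\<^sub>R w)"] x s(3) fq by simp
      then have "s^3 * f (x, (1 / s) *\<^sub>R w) \<le> s^3 * (\<rho> * \<mu>)"
        using s(1) by (intro mult_left_mono) auto
      also have "\<dots> \<le> (s^2 + (s^2)^2) / 2 * (\<rho> * \<mu>)"
      proof (rule mult_right_mono)
        have "0 \<le> (s * (1 - s))^2 / 2" by simp
        also have "\<dots> = (s^2 + (s^2)^2) / 2 - s^3"
          by (simp add: power2_eq_square power3_eq_cube field_simps)
        finally show "s^3 \<le> (s^2 + (s^2)^2) / 2" by simp
      qed (use \<rho> \<mu> in simp)
      finally show ?thesis
        using s(2,4) by (simp add: f_def \<rho>_def mult_ac)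
    qed
    obtain E where E: "frame z E" by (rule frame_exists)
    have "\<rho> * \<mu>^2 / 12 \<le> (\<Sum>a\<in>UNIV. 2 * (E a \<bullet> E a) + 8 * (z \<bullet> E a)^2 / \<rho>)"
      using frame_inequality[OF E zR max e _ \<mu>] by (simp add: \<rho>_def \<mu>_def)
    also have "\<dots> \<le> (\<Sum>a\<in>(UNIV :: ('k + 'l) set). 10 * R^2 / lam / \<rho>)"
    proof (rule sum_mono)
      fix a
      have "metric z (E a) (E a) = 1" using E by (simp add: frame_def)
      then have Ea: "E a \<bullet> E a \<le> 1 / lam"
        using metric_lower[of "E a" z] lam by (simp add: field_simps)
      have zz: "z \<bullet> z \<le> R^2" "\<rho> \<le> R^2" using \<rho> by (simp_all add: \<rho>_def)
      have "(z \<bullet> E a)^2 \<le> (z \<bullet> z) * (E a \<bullet> E a)" by (rule Cauchy_Schwarz_ineq)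
      also have "\<dots> \<le> R^2 * (1 / lam)" using zz Ea by (intro mult_mono) auto
      finally have "(z \<bullet> E a)^2 / \<rho> \<le> R^2 / lam / \<rho>"
        using \<rho> by (intro divide_right_mono) auto
      moreover have "E a \<bullet> E a \<le> R^2 / lam / \<rho>"
      proof -
        have "1 / lam \<le> R^2 / lam / \<rho>" using zz(2) \<rho> lam by (simp add: field_simps)
        then show ?thesis using Ea by linarith
      qed
      moreover have "2 * x + 8 * y \<le> 10 * t" if "y \<le> t" "x \<le> t" for x y t :: real
        using that by linarith
      ultimately have "2 * (E a \<bullet> E a) + 8 * ((z \<bullet> E a)^2 / \<rho>) \<le> 10 * (R^2 / lam / \<rho>)" by blast
      then show "2 * (E a \<bullet> E a) + 8 * (z \<bullet> E a)^2 / \<rho> \<le> 10 * R^2 / lam / \<rho>" by simp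
    qed
    also have "\<dots> = n * (10 * R^2 / lam / \<rho>)" by (simp add: n_def)
    finally have "(12 * \<rho>) * (\<rho> * \<mu>^2 / 12) \<le> (12 * \<rho>) * (n * (10 * R^2 / lam / \<rho>))"
      using \<rho> by (intro mult_left_mono) auto
    moreover have "(12 * \<rho>) * (\<rho> * \<mu>^2 / 12) = (\<rho> * \<mu>)^2" by (simp add: power2_eq_square)
    moreover have "(12 * \<rho>) * (n * (10 * R^2 / lam / \<rho>)) = 120 * n / lam * R^2" using \<rho> by simp
    ultimately have "(\<rho> * \<mu>)^2 \<le> 120 * n / lam * R^2" by simp
    then have "\<rho> * \<mu> \<le> sqrt (120 * n / lam * R^2)"
      by (rule real_le_rsqrt)
    also have "\<dots> = sqrt (120 * n / lam) * R"
      using R by (simp only: real_sqrt_mult real_sqrt_abs abs_of_pos)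
    finally show ?thesis unfolding fq n_def .
  qed
  show ?thesis using q_max[OF yv] bound by (simp add: f_def)
qed

lemma third_derivative_nonpos: "D [v, v, v] y \<le> 0"
proof (cases "v = 0")
  case True
  then show ?thesis using linear_0[OF D_linear[of "[0, 0]" y]] by simp
next
  case False
  obtain s where s: "s > 0" "metric y ((1 / s) *\<^sub>R v) ((1 / s) *\<^sub>R v) = 1"
    "D [v, v, v] y = s^3 * D [(1 / s) *\<^sub>R v, (1 / s) *\<^sub>R v, (1 / s) *\<^sub>R v] y"
    using normalize[OF False] by metis
  define d where "d = D [(1 / s) *\<^sub>R v, (1 / s) *\<^sub>R v, (1 / s) *\<^sub>R v] y"
  define K where "K = sqrt (120 * real CARD('k + 'l) / lam)"
  have K: "K \<ge> 0" using lam by (simp add: K_def)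
  have "d \<le> 0"
  proof (rule ccontr)
    assume "\<not> d \<le> 0"
    then have d: "d > 0" by simp
    \<comment> \<open>Large enough that \<open>R\<^sup>2 - |y|\<^sup>2 \<ge> R\<^sup>2 / 2\<close> and \<open>R d / 2 > K\<close>.\<close>
    define R where "R = 2 * norm y + 2 * K / d + 1"
    have "2 * K / d \<ge> 0" using K d by simp
    then have R: "R \<ge> 2 * norm y" "R > 2 * K / d" "R > 0" "norm y < R"
      using norm_ge_zero[of y] unfolding R_def by linarith+
    have "(2 * norm y)^2 \<le> R^2" using R(1) by (intro power_mono) auto
    then have "4 * (norm y)^2 \<le> R^2" by (simp add: power_mult_distrib)
    then have "R^2 / 2 \<le> R^2 - y \<bullet> y"
      using zero_le_power2[of "norm y"] unfolding power2_norm_eq_inner[symmetric] by linarith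
    then have "R^2 / 2 * d \<le> (R^2 - y \<bullet> y) * d" using d by (intro mult_right_mono) auto
    also have "\<dots> \<le> K * R"
      using interior_cubic_bound[OF R(4) s(2)] by (simp add: d_def K_def)
    finally have "R^2 / 2 * d \<le> K * R" .
    moreover have "R^2 / 2 * d = R * (R * d / 2)" by (simp add: power2_eq_square)
    moreover have "K * R = R * K" by (rule mult.commute)
    ultimately have "R * d / 2 \<le> K" using mult_le_cancel_left_pos[OF R(3)] by metis
    then have "R \<le> 2 * K / d" using d by (simp add: pos_le_divide_eq)
    then show False using R(2) by simp
  qed
  then show ?thesis using s(1,3) by (simp add: d_def mult_nonneg_nonpos)
qed

lemma third_derivative_zero: "D [v, v, v] y = 0"
  using third_derivative_nonpos[of v y] third_derivative_nonpos[of "- v" y]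
    D_cube_scale[of "- 1" v y] unfolding scaleR_minus1_left by simp

text \<open>Along the segment from \<open>0\<close> to \<open>z\<close>, the value at \<open>z\<close> of the quadratic Taylor polynomial of \<open>u\<close> at
  \<open>t z\<close> has derivative \<open>(1 - t)\<^sup>2 / 2\<close> times the third derivative, hence is constant.\<close>

lemma taylor_quadratic: "u z = u 0 + D [z] 0 + D [z, z] 0 / 2"
proof -
  define p where "p t = 0 + t *\<^sub>R z" for t
  define F where "F t = D [] (p t) + (1 - t) * D [z] (p t) + (1 - t)^2 / 2 * D [z, z] (p t)" for t
  have line: "((\<lambda>t. D vs (p t)) has_real_derivative D (z # vs) (p t)) (at t)" for vs t
    unfolding p_def by (rule D_line)
  have "(F has_real_derivative 0) (at t)" for t
  proof -
    have 1: "((\<lambda>t. (1 - t) * D [z] (p t)) has_real_derivative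
        - D [z] (p t) + (1 - t) * D [z, z] (p t)) (at t)"
      by (auto intro!: derivative_eq_intros line)
    have 2: "((\<lambda>t. (1 - t)^2 / 2 * D [z, z] (p t)) has_real_derivative - ((1 - t) * D [z, z] (p t))) (at t)"
      by (auto intro!: derivative_eq_intros line simp: third_derivative_zero field_simps)
    show ?thesis
      unfolding F_def[abs_def]
      using DERIV_add[OF DERIV_add[OF line[of "[]"] 1] 2] by simp
  qed
  then have "F 1 = F 0" using DERIV_isconst_all by blast
  then show ?thesis by (simp add: F_def p_def)
qed

lemma solution_quadratic: "quadratic_polynomial u"
  unfolding quadratic_polynomial_def
proof (intro exI allI)
  fix z :: "(real^'k) \<times> (real^'l)"
  have z: "(\<Sum>b\<in>Basis. (z \<bullet> b) *\<^sub>R b) = z" by (rule euclidean_representation)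
  have "D [z] 0 = (\<Sum>b\<in>Basis. D [b] 0 * (z \<bullet> b))"
    using linear_sum_scaleR[OF D_linear, of "\<lambda>b. z \<bullet> b" "\<lambda>b. b" Basis "[]" 0] z
    by (simp add: mult.commute)
  moreover have "D [z, z] 0 = (\<Sum>a\<in>Basis. (z \<bullet> a) * (\<Sum>b\<in>Basis. (z \<bullet> b) * D [a, b] 0))"
    using linear_sum_scaleR[OF D_linear, of "\<lambda>b. z \<bullet> b" "\<lambda>b. b" Basis "[z]" 0]
      linear_sum_scaleR[OF D_linear2, of _ "\<lambda>b. z \<bullet> b" "\<lambda>b. b" Basis "[]" 0] z
    by simp
  then have "D [z, z] 0 / 2 = (\<Sum>a\<in>Basis. \<Sum>b\<in>Basis. D [a, b] 0 / 2 * (z \<bullet> a) * (z \<bullet> b))"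
    by (simp add: sum_divide_distrib sum_distrib_left mult_ac)
  ultimately show "u z = u 0 + (\<Sum>b\<in>Basis. D [b] 0 * (z \<bullet> b))
      + (\<Sum>a\<in>Basis. \<Sum>b\<in>Basis. D [a, b] 0 / 2 * (z \<bullet> a) * (z \<bullet> b))"
    using taylor_quadratic[of z] by simp
qed

end

theorem corollary2p4:
  fixes u :: "(real^'k) \<times> (real^'l) \<Rightarrow> real"
    and lam Lam :: real
  assumes "lam > 0" and "Lam > 0"
    and "C_infinity u"
    and "\<And>z. matrix_le (lam *\<^sub>R mat 1) (hess_x u z)"
    and "\<And>z. matrix_le (hess_x u z) (Lam *\<^sub>R mat 1)"
    and "\<And>z. matrix_le (lam *\<^sub>R mat 1) (- hess_y u z)"
    and "\<And>z. matrix_le (- hess_y u z) (Lam *\<^sub>R mat 1)"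
    and "\<And>z. ln (det (hess_x u z)) - ln (det (- hess_y u z)) = 0"
  shows "quadratic_polynomial u"
proof -
  interpret saddle_solution u lam Lam
    using assms by unfold_locales
  show ?thesis by (rule solution_quadratic)
qed

end
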